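(* The following are equivalent over $\mathbf{ECST}$: (1) $\mathrm{NID}_{\mathrm{bi}}$: for each set $S$ and each set $R$ of rules on $S$, the class of $R$-biclosed subsets of $S$ is set-generated; (2) the category $\mathbf{Rel}$ of sets and relations has weak equalisers.
   Context: Base theory. $\mathbf{ECST}$ (elementary constructive set theory) is the theory in intuitionistic first-order logic with equality and $\in$ whose axioms are Extensionality, Pairing, Union, Restricted Separation (separation for formulas all of whose quantifiers are bounded), Replacement (for arbitrary formulas, with $\exists!$ in the hypothesis), and Strong Infinity (existence of the least set $\omega$ containing $\emptyset$ and closed under $x\mapsto x\cup\{x\}$). There is no power set axiom; $\mathrm{Pow}(S)$ denotes the class of subsets of $S$. A rule on a set $S$ is a pair $(a,b)$ of subsets of $S$. Write $b\between\alpha$ to mean that $b\cap\alpha$ is inhabited. A subset $\alpha\subseteq S$ is biclosed under $(a,b)$ if $a\between\alpha\iff b\between\alpha$; for a set $R$ of rules, $\alpha$ is $R$-biclosed if it is biclosed under every rule in $R$. A subclass $\mathcal{C}$ of $\mathrm{Pow}(S)$ is set-generated if there is a set $G\subseteq\mathcal{C}$ such that $\forall\alpha\in\mathcal{C}\,\forall x\in\alpha\,\exists\beta\in G\,(x\in\beta\subseteq\alpha)$. $\mathbf{Rel}$ is the category of sets and binary relations, with identities the diagonal relations and relational composition. A weak equaliser of $f,g\colon A\to B$ is an object $E$ with a morphism $e\colon E\to A$ such that $f\circ e=g\circ e$ and, for every $h\colon C\to A$ with $f\circ h=g\circ h$, there exists a (not necessarily unique) $\overline{h}\colon C\to E$ with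 $e\circ\overline{h}=h$. *)

theory Defs
  imports Main
begin

section \<open>Intuitionistic first-order logic with equality and membership\<close>

text \<open>Variables are de Bruijn indices. The language has no function symbols, so variables are the
  only terms and substitution is renaming.\<close>

datatype fm =
    Mem nat nat
  | Equal nat nat
  | Bot
  | And fm fm
  | Or fm fm
  | Imp fm fm
  | Forall fm
  | Exists fm

primrec ren :: "(nat \<Rightarrow> nat) \<Rightarrow> fm \<Rightarrow> fm" where
  "ren s (Mem i j) = Mem (s i) (s j)"
| "ren s (Equal i j) = Equal (s i) (s j)"
| "ren s Bot = Bot"
| "ren s (And p q) = And (ren s p) (ren s q)"
| "ren s (Or p q) = Or (ren s p) (ren s q)"
| "ren s (Imp p q) = Imp (ren s p) (ren s q)"
| "ren s (Forall p) = Forall (ren (case_nat 0 (\<lambda>i. Suc (s i))) p)"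
| "ren s (Exists p) = Exists (ren (case_nat 0 (\<lambda>i. Suc (s i))) p)"

abbreviation lift :: "fm \<Rightarrow> fm" where
  "lift \<equiv> ren Suc"

abbreviation subst0 :: "fm \<Rightarrow> nat \<Rightarrow> fm" where
  "subst0 p i \<equiv> ren (case_nat i (\<lambda>k. k)) p"

primrec fv :: "fm \<Rightarrow> nat set" where
  "fv (Mem i j) = {i, j}"
| "fv (Equal i j) = {i, j}"
| "fv Bot = {}"
| "fv (And p q) = fv p \<union> fv q"
| "fv (Or p q) = fv p \<union> fv q"
| "fv (Imp p q) = fv p \<union> fv q"
| "fv (Forall p) = {i. Suc i \<in> fv p}"
| "fv (Exists p) = {i. Suc i \<in> fv p}"

inductive derives :: "fm set \<Rightarrow> fm \<Rightarrow> bool" (infix \<open>\<turnstile>\<close> 50) where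
  Assm: "p \<in> \<Gamma> \<Longrightarrow> \<Gamma> \<turnstile> p"
| BotE: "\<Gamma> \<turnstile> Bot \<Longrightarrow> \<Gamma> \<turnstile> p"
| AndI: "\<Gamma> \<turnstile> p \<Longrightarrow> \<Gamma> \<turnstile> q \<Longrightarrow> \<Gamma> \<turnstile> And p q"
| AndE1: "\<Gamma> \<turnstile> And p q \<Longrightarrow> \<Gamma> \<turnstile> p"
| AndE2: "\<Gamma> \<turnstile> And p q \<Longrightarrow> \<Gamma> \<turnstile> q"
| OrI1: "\<Gamma> \<turnstile> p \<Longrightarrow> \<Gamma> \<turnstile> Or p q"
| OrI2: "\<Gamma> \<turnstile> q \<Longrightarrow> \<Gamma> \<turnstile> Or p q"
| OrE: "\<Gamma> \<turnstile> Or p q \<Longrightarrow> insert p \<Gamma> \<turnstile> r \<Longrightarrow> insert q \<Gamma> \<turnstile> r \<Longrightarrow> \<Gamma> \<turnstile> r"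
| ImpI: "insert p \<Gamma> \<turnstile> q \<Longrightarrow> \<Gamma> \<turnstile> Imp p q"
| ImpE: "\<Gamma> \<turnstile> Imp p q \<Longrightarrow> \<Gamma> \<turnstile> p \<Longrightarrow> \<Gamma> \<turnstile> q"
| ForallI: "lift ` \<Gamma> \<turnstile> p \<Longrightarrow> \<Gamma> \<turnstile> Forall p"
| ForallE: "\<Gamma> \<turnstile> Forall p \<Longrightarrow> \<Gamma> \<turnstile> subst0 p i"
| ExistsI: "\<Gamma> \<turnstile> subst0 p i \<Longrightarrow> \<Gamma> \<turnstile> Exists p"
| ExistsE: "\<Gamma> \<turnstile> Exists p \<Longrightarrow> insert p (lift ` \<Gamma>) \<turnstile> lift q \<Longrightarrow> \<Gamma> \<turnstile> q"
| EqualI: "\<Gamma> \<turnstile> Equal i i"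
| EqualE: "\<Gamma> \<turnstile> Equal i j \<Longrightarrow> \<Gamma> \<turnstile> subst0 p i \<Longrightarrow> \<Gamma> \<turnstile> subst0 p j"

text \<open>In a bounded quantifier the bounding set \<open>Suc i\<close> is never the variable \<open>0\<close> being bound.\<close>

inductive restricted :: "fm \<Rightarrow> bool" where
  "restricted (Mem i j)"
| "restricted (Equal i j)"
| "restricted Bot"
| "restricted p \<Longrightarrow> restricted q \<Longrightarrow> restricted (And p q)"
| "restricted p \<Longrightarrow> restricted q \<Longrightarrow> restricted (Or p q)"
| "restricted p \<Longrightarrow> restricted q \<Longrightarrow> restricted (Imp p q)"
| "restricted p \<Longrightarrow> restricted (Forall (Imp (Mem 0 (Suc i)) p))"
| "restricted p \<Longrightarrow> restricted (Exists (And (Mem 0 (Suc i)) p))"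


section \<open>Writing formulas with named binders\<close>

text \<open>A \<^emph>\<open>formula in context\<close> maps the number \<open>n\<close> of enclosing quantifiers to a formula. A bound
  variable is represented by its level, the number of quantifiers enclosing its own binder; below
  \<open>n\<close> quantifiers the variable of level \<open>x\<close> has de Bruijn index \<open>n - Suc x\<close>. Applying a formula in
  context to \<open>0\<close> yields the ordinary formula.\<close>

type_synonym var = nat
type_synonym cfm = "nat \<Rightarrow> fm"

definition c_mem :: "var \<Rightarrow> var \<Rightarrow> cfm" (infix \<open>\<^bold>\<in>\<close> 50) where
  "(x \<^bold>\<in> y) = (\<lambda>n. Mem (n - Suc x) (n - Suc y))"

definition c_eq :: "var \<Rightarrow> var \<Rightarrow> cfm" (infix \<open>\<^bold>=\<close> 50) where
  "(x \<^bold>= y) = (\<lambda>n. Equal (n - Suc x) (n - Suc y))"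

definition c_bot :: cfm (\<open>\<^bold>\<bottom>\<close>) where
  "\<^bold>\<bottom> = (\<lambda>n. Bot)"

definition c_and :: "cfm \<Rightarrow> cfm \<Rightarrow> cfm" (infixr \<open>\<^bold>\<and>\<close> 35) where
  "(P \<^bold>\<and> Q) = (\<lambda>n. And (P n) (Q n))"

definition c_or :: "cfm \<Rightarrow> cfm \<Rightarrow> cfm" (infixr \<open>\<^bold>\<or>\<close> 30) where
  "(P \<^bold>\<or> Q) = (\<lambda>n. Or (P n) (Q n))"

definition c_imp :: "cfm \<Rightarrow> cfm \<Rightarrow> cfm" (infixr \<open>\<^bold>\<longrightarrow>\<close> 25) where
  "(P \<^bold>\<longrightarrow> Q) = (\<lambda>n. Imp (P n) (Q n))"

definition c_iff :: "cfm \<Rightarrow> cfm \<Rightarrow> cfm" (infixr \<open>\<^bold>\<longleftrightarrow>\<close> 25) where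
  "(P \<^bold>\<longleftrightarrow> Q) = ((P \<^bold>\<longrightarrow> Q) \<^bold>\<and> (Q \<^bold>\<longrightarrow> P))"

definition c_all :: "(var \<Rightarrow> cfm) \<Rightarrow> cfm" (binder \<open>\<^bold>\<forall>\<close> 10) where
  "(\<^bold>\<forall>x. P x) = (\<lambda>n. Forall (P n (Suc n)))"

definition c_ex :: "(var \<Rightarrow> cfm) \<Rightarrow> cfm" (binder \<open>\<^bold>\<exists>\<close> 10) where
  "(\<^bold>\<exists>x. P x) = (\<lambda>n. Exists (P n (Suc n)))"

definition c_ex1 :: "(var \<Rightarrow> cfm) \<Rightarrow> cfm" (binder \<open>\<^bold>\<exists>\<^bold>!\<close> 10) where
  "(\<^bold>\<exists>\<^bold>!x. P x) = (\<^bold>\<exists>x. P x \<^bold>\<and> (\<^bold>\<forall>y. P y \<^bold>\<longrightarrow> y \<^bold>= x))"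

text \<open>\<open>inst p xs\<close> is \<open>p\<close> with its first \<open>length xs\<close> free variables replaced by \<open>xs\<close>; the
  remaining free variables of \<open>p\<close> stay free, as parameters.\<close>

definition inst :: "fm \<Rightarrow> var list \<Rightarrow> cfm" where
  "inst p xs = (\<lambda>n. ren (\<lambda>i. if i < length xs then n - Suc (xs ! i) else n + (i - length xs)) p)"


section \<open>Elementary constructive set theory\<close>

definition c_subset :: "var \<Rightarrow> var \<Rightarrow> cfm" (infix \<open>\<^bold>\<subseteq>\<close> 50) where
  "(x \<^bold>\<subseteq> y) = (\<^bold>\<forall>z. z \<^bold>\<in> x \<^bold>\<longrightarrow> z \<^bold>\<in> y)"

definition ax_extensionality :: cfm where
  "ax_extensionality = (\<^bold>\<forall>a b. (\<^bold>\<forall>x. x \<^bold>\<in> a \<^bold>\<longleftrightarrow> x \<^bold>\<in> b) \<^bold>\<longrightarrow> a \<^bold>= b)"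

definition ax_pairing :: cfm where
  "ax_pairing = (\<^bold>\<forall>a b. \<^bold>\<exists>c. \<^bold>\<forall>x. x \<^bold>\<in> c \<^bold>\<longleftrightarrow> (x \<^bold>= a \<^bold>\<or> x \<^bold>= b))"

definition ax_union :: cfm where
  "ax_union = (\<^bold>\<forall>a. \<^bold>\<exists>b. \<^bold>\<forall>x. x \<^bold>\<in> b \<^bold>\<longleftrightarrow> (\<^bold>\<exists>y. y \<^bold>\<in> a \<^bold>\<and> x \<^bold>\<in> y))"

definition ax_separation :: "fm \<Rightarrow> cfm" where
  "ax_separation p = (\<^bold>\<forall>a. \<^bold>\<exists>b. \<^bold>\<forall>x. x \<^bold>\<in> b \<^bold>\<longleftrightarrow> (x \<^bold>\<in> a \<^bold>\<and> inst p [x, a]))"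

definition ax_replacement :: "fm \<Rightarrow> cfm" where
  "ax_replacement p =
    (\<^bold>\<forall>a. (\<^bold>\<forall>x. x \<^bold>\<in> a \<^bold>\<longrightarrow> (\<^bold>\<exists>\<^bold>!y. inst p [x, y, a])) \<^bold>\<longrightarrow>
      (\<^bold>\<exists>b. \<^bold>\<forall>y. y \<^bold>\<in> b \<^bold>\<longleftrightarrow> (\<^bold>\<exists>x. x \<^bold>\<in> a \<^bold>\<and> inst p [x, y, a])))"

definition is_empty :: "var \<Rightarrow> cfm" where
  "is_empty x = (\<^bold>\<forall>z. z \<^bold>\<in> x \<^bold>\<longrightarrow> \<^bold>\<bottom>)"

definition is_succ :: "var \<Rightarrow> var \<Rightarrow> cfm" where
  "is_succ y x = (\<^bold>\<forall>z. z \<^bold>\<in> y \<^bold>\<longleftrightarrow> (z \<^bold>\<in> x \<^bold>\<or> z \<^bold>= x))"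

definition is_inductive :: "var \<Rightarrow> cfm" where
  "is_inductive a =
    ((\<^bold>\<exists>x. x \<^bold>\<in> a \<^bold>\<and> is_empty x) \<^bold>\<and>
     (\<^bold>\<forall>x. x \<^bold>\<in> a \<^bold>\<longrightarrow> (\<^bold>\<exists>y. y \<^bold>\<in> a \<^bold>\<and> is_succ y x)))"

definition ax_strong_infinity :: cfm where
  "ax_strong_infinity =
    (\<^bold>\<exists>a. is_inductive a \<^bold>\<and> (\<^bold>\<forall>b. is_inductive b \<^bold>\<longrightarrow> a \<^bold>\<subseteq> b))"

definition universal_closures :: "fm \<Rightarrow> fm set" where
  "universal_closures p = {(Forall ^^ k) p |k. fv ((Forall ^^ k) p) = {}}"

definition ECST :: "fm set" where
  "ECST =
    {ax_extensionality 0, ax_pairing 0, ax_union 0, ax_strong_infinity 0} \<union>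
    (\<Union>p \<in> {p. restricted p}. universal_closures (ax_separation p 0)) \<union>
    (\<Union>p. universal_closures (ax_replacement p 0))"


section \<open>Rules and set-generated classes\<close>

definition is_upair :: "var \<Rightarrow> var \<Rightarrow> var \<Rightarrow> cfm" where
  "is_upair z x y = (x \<^bold>\<in> z \<^bold>\<and> y \<^bold>\<in> z \<^bold>\<and> (\<^bold>\<forall>w. w \<^bold>\<in> z \<^bold>\<longrightarrow> (w \<^bold>= x \<^bold>\<or> w \<^bold>= y)))"

text \<open>\<open>p\<close> is the Kuratowski pair \<open>{{x}, {x, y}}\<close>; the formula is restricted.\<close>

definition is_pair :: "var \<Rightarrow> var \<Rightarrow> var \<Rightarrow> cfm" where
  "is_pair p x y =
    (\<^bold>\<exists>u. u \<^bold>\<in> p \<^bold>\<and> (\<^bold>\<exists>v. v \<^bold>\<in> p \<^bold>\<and> is_upair u x x \<^bold>\<and> is_upair v x y \<^bold>\<and> is_upair p u v))"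

definition rules_on :: "var \<Rightarrow> var \<Rightarrow> cfm" where
  "rules_on S R = (\<^bold>\<forall>r. r \<^bold>\<in> R \<^bold>\<longrightarrow> (\<^bold>\<exists>a b. is_pair r a b \<^bold>\<and> a \<^bold>\<subseteq> S \<^bold>\<and> b \<^bold>\<subseteq> S))"

definition overlaps :: "var \<Rightarrow> var \<Rightarrow> cfm" where
  "overlaps b \<alpha> = (\<^bold>\<exists>x. x \<^bold>\<in> b \<^bold>\<and> x \<^bold>\<in> \<alpha>)"

definition biclosed :: "var \<Rightarrow> var \<Rightarrow> cfm" where
  "biclosed R \<alpha> =
    (\<^bold>\<forall>r. r \<^bold>\<in> R \<^bold>\<longrightarrow> (\<^bold>\<forall>a b. is_pair r a b \<^bold>\<longrightarrow> (overlaps a \<alpha> \<^bold>\<longleftrightarrow> overlaps b \<alpha>)))"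

definition set_generated :: "(var \<Rightarrow> cfm) \<Rightarrow> cfm" where
  "set_generated C =
    (\<^bold>\<exists>G. (\<^bold>\<forall>\<beta>. \<beta> \<^bold>\<in> G \<^bold>\<longrightarrow> C \<beta>) \<^bold>\<and>
      (\<^bold>\<forall>\<alpha>. C \<alpha> \<^bold>\<longrightarrow>
        (\<^bold>\<forall>x. x \<^bold>\<in> \<alpha> \<^bold>\<longrightarrow> (\<^bold>\<exists>\<beta>. \<beta> \<^bold>\<in> G \<^bold>\<and> x \<^bold>\<in> \<beta> \<^bold>\<and> \<beta> \<^bold>\<subseteq> \<alpha>))))"

definition NID_bi :: cfm where
  "NID_bi = (\<^bold>\<forall>S R. rules_on S R \<^bold>\<longrightarrow> set_generated (\<lambda>\<alpha>. \<alpha> \<^bold>\<subseteq> S \<^bold>\<and> biclosed R \<alpha>))"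


section \<open>Weak equalisers and the category of relations\<close>

text \<open>Weak equalisers in a category whose objects are all sets: \<open>hom f A B\<close> says that \<open>f\<close> is a
  morphism from \<open>A\<close> to \<open>B\<close>, and \<open>composite k g f\<close> says that \<open>k\<close> is the composite of \<open>g\<close> after \<open>f\<close>.
  An equation between two composites is expressed by a common value \<open>k\<close>.\<close>

definition has_weak_equalisers ::
    "(var \<Rightarrow> var \<Rightarrow> var \<Rightarrow> cfm) \<Rightarrow> (var \<Rightarrow> var \<Rightarrow> var \<Rightarrow> cfm) \<Rightarrow> cfm" where
  "has_weak_equalisers hom composite =
    (\<^bold>\<forall>A B f g. hom f A B \<^bold>\<and> hom g A B \<^bold>\<longrightarrow>
      (\<^bold>\<exists>E e. hom e E A \<^bold>\<and> (\<^bold>\<exists>k. composite k f e \<^bold>\<and> composite k g e) \<^bold>\<and>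
        (\<^bold>\<forall>C h. hom h C A \<^bold>\<and> (\<^bold>\<exists>k. composite k f h \<^bold>\<and> composite k g h) \<^bold>\<longrightarrow>
          (\<^bold>\<exists>h'. hom h' C E \<^bold>\<and> composite h e h'))))"

definition rel_hom :: "var \<Rightarrow> var \<Rightarrow> var \<Rightarrow> cfm" where
  "rel_hom f A B =
    (\<^bold>\<forall>p. p \<^bold>\<in> f \<^bold>\<longrightarrow> (\<^bold>\<exists>x. x \<^bold>\<in> A \<^bold>\<and> (\<^bold>\<exists>y. y \<^bold>\<in> B \<^bold>\<and> is_pair p x y)))"

definition related :: "var \<Rightarrow> var \<Rightarrow> var \<Rightarrow> cfm" where
  "related f x y = (\<^bold>\<exists>p. p \<^bold>\<in> f \<^bold>\<and> is_pair p x y)"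

definition rel_comp :: "var \<Rightarrow> var \<Rightarrow> var \<Rightarrow> cfm" where
  "rel_comp k g f =
    (\<^bold>\<forall>p. p \<^bold>\<in> k \<^bold>\<longleftrightarrow> (\<^bold>\<exists>x y z. is_pair p x z \<^bold>\<and> related f x y \<^bold>\<and> related g y z))"

definition Rel_has_weak_equalisers :: cfm where
  "Rel_has_weak_equalisers = has_weak_equalisers rel_hom rel_comp"

end

theory Submission
  imports Defs "HOL-Library.FSet"
begin

text \<open>
  \<^emph>\<open>The mathematical argument.\<close> Given relations \<open>f, g\<close> from \<open>A\<close> to \<open>B\<close>, call \<open>\<alpha> \<subseteq> A\<close> \<^emph>\<open>balanced\<close> if
  \<open>f\<close> and \<open>g\<close> relate members of \<open>\<alpha>\<close> to the same elements of \<open>B\<close>. When \<open>\<alpha>\<close> is read as a relation from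
  a singleton to \<open>A\<close>, this says that \<open>\<alpha>\<close> equalises \<open>f\<close> and \<open>g\<close>. Balancedness is the link between the
  two sides of the theorem.

  If \<open>e\<close> from \<open>E\<close> to \<open>A\<close> is a weak equaliser of \<open>f\<close> and \<open>g\<close>, then every image \<open>e[t]\<close> with \<open>t \<in> E\<close> is
  balanced, and since a balanced \<open>\<alpha>\<close> factors through \<open>e\<close>, it is a union of such images; so the
  set of images generates the balanced subsets (\<open>Set_generated_of_Weak_equaliser\<close>). Conversely, if a
  set \<open>G\<close> generates the balanced subsets, then the relation \<open>\<ni>\<close> from \<open>G\<close> to \<open>A\<close> is a weak equaliser: a
  relation \<open>h\<close> from \<open>C\<close> to \<open>A\<close> that equalises \<open>f\<close> and \<open>g\<close> has balanced images \<open>h[c]\<close>, each of which is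
  the union of the \<open>\<beta> \<in> G\<close> that it includes, so \<open>h\<close> factors through the relation \<open>\<beta> \<subseteq> h[c]\<close>
  between \<open>c\<close> and \<open>\<beta>\<close> (\<open>Weak_equaliser_of_Set_generated\<close>).

  It remains to compare balanced with biclosed subsets. The balanced subsets for \<open>f\<close> and \<open>g\<close> are the
  subsets biclosed under the rules consisting of the fibres of \<open>f\<close> and \<open>g\<close> over a point of \<open>B\<close>
  (\<open>ex_presented_rules\<close>); and each set \<open>R\<close> of rules on \<open>S\<close> arises in this way from the two relations
  from \<open>S\<close> to \<open>R\<close> that hold between \<open>x\<close> and \<open>(a, b)\<close> if \<open>x \<in> a\<close>, respectively \<open>x \<in> b\<close>
  (\<open>ex_presenting_relations\<close>). The argument can be carried out in ECST because every relation it constructs is cut out of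
  a product of two given sets by a restricted formula (\<open>relation_comprehension\<close>).

  \<^emph>\<open>Reasoning inside ECST.\<close> The derivation is obtained from a forcing semantics rather than written
  out. A world is a finite set of formulas that are assumed in addition to ECST, and a world
  forces a formula if it derives it. Implication then quantifies over larger worlds. Since the axioms
  are closed and a world is finite, a fresh variable always exists, and so a universal formula is
  forced as soon as all its instances by variables are: the variables themselves serve as a
  domain that does not vary with the world. Disjunctions and existential statements need not be forced
  by way of a disjunct or a witness; instead they may be eliminated in favour of any truth value, where
  the truth values are the sets of worlds fixed by a closure operator that is defined from derivability
  (\<open>cover_closure\<close>). Interpreting formulas by truth values commutes with conjunction,
  disjunction, implication and the quantifiers (\<open>ev_simps\<close>), so it suffices to show
  that the equivalence is forced, and this can be argued with HOL variables and rules. Such an argument moves to a larger world whenever an assumption is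
  introduced or an existential statement is eliminated, and \<open>forces_mono\<close> carries earlier facts along.
\<close>

section \<open>Renaming and weakening of derivations\<close>

text \<open>Environments are extended at index \<open>0\<close>, as by a quantifier.\<close>

abbreviation ext :: "nat \<Rightarrow> (nat \<Rightarrow> nat) \<Rightarrow> nat \<Rightarrow> nat" (infixr \<open>##\<close> 65) where
  "x ## e \<equiv> case_nat x e"

lemma ren_ren: "ren s (ren t p) = ren (\<lambda>i. s (t i)) p"
proof (induction p arbitrary: s t)
  case (Forall p)
  have "(\<lambda>i. (0 ## (\<lambda>i. Suc (s i))) ((0 ## (\<lambda>i. Suc (t i))) i)) = 0 ## (\<lambda>i. Suc (s (t i)))"
    by (auto simp: fun_eq_iff split: nat.split)
  with Forall show ?case by simp
next
  case (Exists p)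
  have "(\<lambda>i. (0 ## (\<lambda>i. Suc (s i))) ((0 ## (\<lambda>i. Suc (t i))) i)) = 0 ## (\<lambda>i. Suc (s (t i)))"
    by (auto simp: fun_eq_iff split: nat.split)
  with Exists show ?case by simp
qed auto

lemma ren_cong: "(\<And>i. i \<in> fv p \<Longrightarrow> s i = t i) \<Longrightarrow> ren s p = ren t p"
proof (induction p arbitrary: s t)
  case (Forall p)
  have "ren (0 ## (\<lambda>i. Suc (s i))) p = ren (0 ## (\<lambda>i. Suc (t i))) p"
  proof (rule Forall.IH)
    show "(0 ## (\<lambda>i. Suc (s i))) i = (0 ## (\<lambda>i. Suc (t i))) i" if "i \<in> fv p" for i
      using Forall.prems that by (cases i) simp_all
  qed
  then show ?case by simp
next
  case (Exists p)
  have "ren (0 ## (\<lambda>i. Suc (s i))) p = ren (0 ## (\<lambda>i. Suc (t i))) p"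
  proof (rule Exists.IH)
    show "(0 ## (\<lambda>i. Suc (s i))) i = (0 ## (\<lambda>i. Suc (t i))) i" if "i \<in> fv p" for i
      using Exists.prems that by (cases i) simp_all
  qed
  then show ?case by simp
next
  case (And p q)
  show ?case using And.IH[of s t] And.prems by simp
next
  case (Or p q)
  show ?case using Or.IH[of s t] Or.prems by simp
next
  case (Imp p q)
  show ?case using Imp.IH[of s t] Imp.prems by simp
qed simp_all

lemma ren_id: "ren (\<lambda>i. i) p = p"
proof -
  have up: "0 ## (\<lambda>i. Suc i) = (\<lambda>i. i)"
    by (auto simp: fun_eq_iff split: nat.split)
  show ?thesis by (induction p) (simp_all only: ren.simps up)
qed

lemma ren_closed: "fv p = {} \<Longrightarrow> ren s p = p"
  using ren_cong[of p s "\<lambda>i. i"] by (simp add: ren_id)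

lemma finite_fv: "finite (fv p)"
proof (induction p)
  case (Forall p)
  then show ?case using finite_vimageI[of "fv p" Suc] by (simp add: vimage_def)
next
  case (Exists p)
  then show ?case using finite_vimageI[of "fv p" Suc] by (simp add: vimage_def)
qed auto

lemma restricted_ren: "restricted p \<Longrightarrow> restricted (ren s p)"
  by (induction arbitrary: s rule: restricted.induct) (auto intro: restricted.intros)

lemma derives_mono: "\<Gamma> \<turnstile> p \<Longrightarrow> \<Gamma> \<subseteq> \<Delta> \<Longrightarrow> \<Delta> \<turnstile> p"
proof (induction arbitrary: \<Delta> rule: derives.induct)
  case (OrE \<Gamma> p q r)
  show ?case
    by (rule derives.OrE[OF OrE.IH(1)[OF OrE.prems] OrE.IH(2,3)[OF insert_mono[OF OrE.prems]]])
next
  case (ImpI p \<Gamma> q)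
  show ?case by (rule derives.ImpI[OF ImpI.IH[OF insert_mono[OF ImpI.prems]]])
next
  case (ForallI \<Gamma> p)
  show ?case by (rule derives.ForallI[OF ForallI.IH[OF image_mono[OF ForallI.prems]]])
next
  case (ExistsE \<Gamma> p q)
  show ?case
    by (rule derives.ExistsE[OF ExistsE.IH(1)[OF ExistsE.prems]
          ExistsE.IH(2)[OF insert_mono[OF image_mono[OF ExistsE.prems]]]])
next
  case (EqualE \<Gamma> i j p)
  show ?case by (rule derives.EqualE[OF EqualE.IH(1,2)[OF EqualE.prems]])
next
  case (ImpE \<Gamma> p q)
  show ?case by (rule derives.ImpE[OF ImpE.IH(1,2)[OF ImpE.prems]])
next
  case (AndI \<Gamma> p q)
  show ?case by (rule derives.AndI[OF AndI.IH(1,2)[OF AndI.prems]])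
next
  case (ExistsI \<Gamma> p i)
  show ?case by (rule derives.ExistsI[OF ExistsI.IH[OF ExistsI.prems]])
next
  case (Assm p \<Gamma>)
  show ?case by (rule derives.Assm[OF subsetD[OF Assm.prems Assm.hyps]])
next
  case (BotE \<Gamma> p)
  show ?case by (rule derives.BotE[OF BotE.IH[OF BotE.prems]])
next
  case (AndE1 \<Gamma> p q)
  show ?case by (rule derives.AndE1[OF AndE1.IH[OF AndE1.prems]])
next
  case (AndE2 \<Gamma> p q)
  show ?case by (rule derives.AndE2[OF AndE2.IH[OF AndE2.prems]])
next
  case (OrI1 \<Gamma> p q)
  show ?case by (rule derives.OrI1[OF OrI1.IH[OF OrI1.prems]])
next
  case (OrI2 \<Gamma> q p)
  show ?case by (rule derives.OrI2[OF OrI2.IH[OF OrI2.prems]])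
next
  case (ForallE \<Gamma> p i)
  show ?case by (rule derives.ForallE[OF ForallE.IH[OF ForallE.prems]])
qed (rule derives.EqualI)

lemma ren_subst0: "ren s (subst0 p i) = subst0 (ren (0 ## (\<lambda>i. Suc (s i))) p) (s i)"
  unfolding ren_ren by (rule ren_cong) (auto split: nat.split)

lemma ren_lift_image:
  "ren (0 ## (\<lambda>i. Suc (s i))) ` lift ` \<Gamma> = lift ` ren s ` \<Gamma>"
  by (simp add: image_image ren_ren)

lemma derives_ren: "\<Gamma> \<turnstile> p \<Longrightarrow> ren s ` \<Gamma> \<turnstile> ren s p"
proof (induction arbitrary: s rule: derives.induct)
  case (ForallI \<Gamma> p)
  have "lift ` ren s ` \<Gamma> \<turnstile> ren (0 ## (\<lambda>i. Suc (s i))) p"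
    using ForallI.IH[of "0 ## (\<lambda>i. Suc (s i))"] by (simp only: ren_lift_image)
  then show ?case unfolding ren.simps by (rule derives.ForallI)
next
  case (ExistsE \<Gamma> p q)
  have "ren (0 ## (\<lambda>i. Suc (s i))) (lift q) = lift (ren s q)"
    by (simp add: ren_ren)
  then have "insert (ren (0 ## (\<lambda>i. Suc (s i))) p) (lift ` ren s ` \<Gamma>) \<turnstile> lift (ren s q)"
    using ExistsE.IH(2)[of "0 ## (\<lambda>i. Suc (s i))"] by (simp only: image_insert ren_lift_image)
  moreover have "ren s ` \<Gamma> \<turnstile> Exists (ren (0 ## (\<lambda>i. Suc (s i))) p)"
    using ExistsE.IH(1)[of s] by simp
  ultimately show ?case by (rule derives.ExistsE[rotated])
next
  case (EqualE \<Gamma> i j p)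
  show ?case
    unfolding ren_subst0
    by (rule derives.EqualE[where i = "s i"])
      (use EqualE.IH[of s] in \<open>simp_all only: ren.simps ren_subst0\<close>)
next
  case (ForallE \<Gamma> p i)
  show ?case unfolding ren_subst0
    by (rule derives.ForallE) (use ForallE.IH[of s] in \<open>simp only: ren.simps\<close>)
next
  case (ExistsI \<Gamma> p i)
  show ?case unfolding ren.simps
    by (rule derives.ExistsI[where i = "s i"]) (use ExistsI.IH[of s] in \<open>simp only: ren_subst0\<close>)
next
  case (OrE \<Gamma> p q r)
  show ?case
    by (rule derives.OrE[of _ "ren s p" "ren s q"])
      (use OrE.IH[of s] in \<open>simp_all only: ren.simps image_insert\<close>)
next
  case (ImpE \<Gamma> p q)
  show ?case
    by (rule derives.ImpE[of _ "ren s p"]) (use ImpE.IH[of s] in \<open>simp_all only: ren.simps\<close>)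
next
  case (ImpI p \<Gamma> q)
  show ?case unfolding ren.simps
    by (rule derives.ImpI) (use ImpI.IH[of s] in \<open>simp only: image_insert\<close>)
next
  case (BotE \<Gamma> p)
  show ?case by (rule derives.BotE) (use BotE.IH[of s] in \<open>simp only: ren.simps\<close>)
next
  case (AndE1 \<Gamma> p q)
  show ?case by (rule derives.AndE1) (use AndE1.IH[of s] in \<open>simp only: ren.simps\<close>)
next
  case (AndE2 \<Gamma> p q)
  show ?case by (rule derives.AndE2) (use AndE2.IH[of s] in \<open>simp only: ren.simps\<close>)
qed (simp_all add: derives.Assm derives.AndI derives.OrI1 derives.OrI2 derives.EqualI)

section \<open>Finite extensions of ECST as worlds\<close>

lemma ECST_closed: "p \<in> ECST \<Longrightarrow> fv p = {}"
  by (auto simp: ECST_def universal_closures_def ax_extensionality_def ax_pairing_def ax_union_def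
      ax_strong_infinity_def is_inductive_def is_empty_def is_succ_def c_subset_def
      c_mem_def c_eq_def c_bot_def c_and_def c_or_def c_imp_def c_iff_def c_all_def c_ex_def)

type_synonym world = "fm fset"

definition prv :: "world \<Rightarrow> fm \<Rightarrow> bool" where
  "prv w p \<longleftrightarrow> ECST \<union> fset w \<turnstile> p"

lemma prv_mono: "prv w p \<Longrightarrow> w \<le> v \<Longrightarrow> prv v p"
  unfolding prv_def by (rule derives_mono) (auto simp: less_eq_fset.rep_eq)

lemma prv_assm: "prv (finsert p w) p"
  unfolding prv_def by (rule derives.Assm) simp

lemma prv_Imp: "prv w (Imp p q) \<longleftrightarrow> (\<forall>v\<ge>w. prv v p \<longrightarrow> prv v q)"
proof
  assume "prv w (Imp p q)"
  then show "\<forall>v\<ge>w. prv v p \<longrightarrow> prv v q"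
    by (metis derives.ImpE prv_def prv_mono)
next
  assume "\<forall>v\<ge>w. prv v p \<longrightarrow> prv v q"
  moreover have "w \<le> finsert p w" by auto
  ultimately have "prv (finsert p w) q" using prv_assm by blast
  then show "prv w (Imp p q)" by (simp add: prv_def derives.ImpI)
qed

text \<open>Only the finitely many formulas outside ECST can use up variables; this is why worlds are finite.\<close>

lemma fresh_variable: "\<exists>x. \<forall>p \<in> ECST \<union> fset w \<union> fset u. x \<notin> fv p"
proof -
  have "finite (\<Union>p \<in> fset w \<union> fset u. fv p)" by (simp add: finite_fv)
  then obtain x where "x \<notin> (\<Union>p \<in> fset w \<union> fset u. fv p)"
    using ex_new_if_finite infinite_UNIV_nat by blast
  then show ?thesis using ECST_closed by fastforce
qed

text \<open>Generalisation over a fresh variable \<open>x\<close>: the renaming that sends \<open>x\<close> to the bound position \<open>0\<close> and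
shifts all other variables undoes the instantiation of \<open>p\<close> at \<open>x\<close>, while on formulas without \<open>x\<close> it is
\<open>lift\<close>. It therefore turns a derivation about \<open>x\<close> into a premise of the rules \<open>ForallI\<close> and \<open>ExistsE\<close>.\<close>

lemma ren_unfresh:
  assumes "x \<notin> fv (Forall p)"
  shows "ren (\<lambda>i. if i = x then 0 else Suc i) (subst0 p x) = p"
proof -
  have "ren (\<lambda>i. if i = x then 0 else Suc i) (subst0 p x) = ren (\<lambda>i. i) p"
    unfolding ren_ren using assms by (intro ren_cong) (auto split: nat.split)
  then show ?thesis by (simp add: ren_id)
qed

lemma lift_fresh:
  assumes "x \<notin> fv p" shows "ren (\<lambda>i. if i = x then 0 else Suc i) p = lift p"
  using assms by (intro ren_cong) auto

lemma prv_Forall: "prv w (Forall p) \<longleftrightarrow> (\<forall>x. prv w (subst0 p x))"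
proof
  assume "prv w (Forall p)"
  then show "\<forall>x. prv w (subst0 p x)" by (auto simp: prv_def intro: derives.ForallE)
next
  assume all: "\<forall>x. prv w (subst0 p x)"
  obtain x where x: "\<And>q. q \<in> ECST \<union> fset w \<Longrightarrow> x \<notin> fv q" "x \<notin> fv (Forall p)"
    using fresh_variable[of w "{|Forall p|}"] by auto
  let ?s = "\<lambda>i. if i = x then 0 else Suc i"
  have "ren ?s ` (ECST \<union> fset w) \<turnstile> ren ?s (subst0 p x)"
    by (rule derives_ren) (use all in \<open>simp add: prv_def\<close>)
  moreover have "ren ?s ` (ECST \<union> fset w) = lift ` (ECST \<union> fset w)"
    by (intro image_cong lift_fresh x) simp_all
  ultimately show "prv w (Forall p)"
    unfolding prv_def ren_unfresh[OF x(2)] by (simp only: derives.ForallI)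
qed

lemma prv_Exists_elim:
  assumes "prv w (Exists p)" and step: "\<And>v x. w \<le> v \<Longrightarrow> prv v (subst0 p x) \<Longrightarrow> prv v r"
  shows "prv w r"
proof -
  obtain x where x: "\<And>q. q \<in> ECST \<union> fset w \<Longrightarrow> x \<notin> fv q" "x \<notin> fv (Forall p)" "x \<notin> fv r"
    using fresh_variable[of w "{|Forall p, r|}"] by auto
  let ?s = "\<lambda>i. if i = x then 0 else Suc i"
  have "prv (finsert (subst0 p x) w) r"
    by (rule step[of _ x]) (auto simp: prv_assm)
  then have "ren ?s ` (insert (subst0 p x) (ECST \<union> fset w)) \<turnstile> ren ?s r"
    unfolding prv_def by (intro derives_ren) simp
  moreover have "ren ?s ` (ECST \<union> fset w) = lift ` (ECST \<union> fset w)"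
    by (intro image_cong lift_fresh x) simp_all
  ultimately have "insert p (lift ` (ECST \<union> fset w)) \<turnstile> lift r"
    by (simp only: image_insert ren_unfresh[OF x(2)] lift_fresh[OF x(3)])
  then show ?thesis using assms(1) unfolding prv_def by (blast intro: derives.ExistsE)
qed

section \<open>Truth values\<close>

text \<open>A world belongs to the closure of \<open>U\<close> if from there on \<open>U\<close> may be assumed in proving any formula:
whatever holds throughout the part of \<open>U\<close> above a world is derivable at that world. A world that
derives a disjunction or an existential formula is in this relation to the set of worlds that derive a
disjunct or an instance. The quantification over \<open>v\<close> makes closed sets upward closed.\<close>

definition cover_closure :: "world set \<Rightarrow> world set" where
  "cover_closure U = {w. \<forall>v\<ge>w. \<forall>r. (\<forall>u\<ge>v. u \<in> U \<longrightarrow> prv u r) \<longrightarrow> prv v r}"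

typedef tv = "{U. cover_closure U = U}"
proof
  show "UNIV \<in> {U. cover_closure U = U}" by (auto simp: cover_closure_def)
qed

definition forces :: "world \<Rightarrow> tv \<Rightarrow> bool" (infix \<open>\<tturnstile>\<close> 45) where
  "w \<tturnstile> P \<longleftrightarrow> w \<in> Rep_tv P"

lemma forces_mono: "w \<tturnstile> P \<Longrightarrow> w \<le> v \<Longrightarrow> v \<tturnstile> P"
proof -
  have "\<And>U. w \<in> cover_closure U \<Longrightarrow> w \<le> v \<Longrightarrow> v \<in> cover_closure U"
    unfolding cover_closure_def by (auto intro: order.trans)
  then show "w \<tturnstile> P \<Longrightarrow> w \<le> v \<Longrightarrow> v \<tturnstile> P"
    unfolding forces_def using Rep_tv[of P] by auto
qed

text \<open>To force a truth value it suffices to derive, at every larger world, each formula that follows from it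
there; the rules \<open>OrE\<close> and \<open>ExistsE\<close> apply to such a derivation.\<close>

lemma forces_local:
  assumes "\<And>v r. w \<le> v \<Longrightarrow> (\<And>u. v \<le> u \<Longrightarrow> u \<tturnstile> P \<Longrightarrow> prv u r) \<Longrightarrow> prv v r"
  shows "w \<tturnstile> P"
proof -
  have "w \<in> cover_closure (Rep_tv P)"
    using assms by (auto simp: cover_closure_def forces_def)
  then show ?thesis using Rep_tv[of P] by (simp add: forces_def)
qed

lemma forces_Abs_tv:
  assumes up: "\<And>w v. P w \<Longrightarrow> w \<le> v \<Longrightarrow> P v"
    and loc: "\<And>w. (\<And>v r. w \<le> v \<Longrightarrow> (\<And>u. v \<le> u \<Longrightarrow> P u \<Longrightarrow> prv u r) \<Longrightarrow> prv v r) \<Longrightarrow> P w"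
  shows "w \<tturnstile> Abs_tv {w. P w} \<longleftrightarrow> P w"
proof -
  have "cover_closure {w. P w} = {w. P w}"
  proof (intro equalityI subsetI)
    fix w assume "w \<in> {w. P w}"
    then show "w \<in> cover_closure {w. P w}"
      using up[of w] by (simp add: cover_closure_def)
  next
    fix w assume "w \<in> cover_closure {w. P w}"
    then show "w \<in> {w. P w}"
      using loc[of w] by (simp add: cover_closure_def)
  qed
  then show ?thesis by (simp add: forces_def Abs_tv_inverse)
qed

definition tval :: "fm \<Rightarrow> tv" where "tval p = Abs_tv {w. prv w p}"

lemma forces_tval: "w \<tturnstile> tval p \<longleftrightarrow> prv w p"
  unfolding tval_def by (rule forces_Abs_tv) (auto intro: prv_mono)

definition tv_Inf :: "tv set \<Rightarrow> tv" where "tv_Inf X = Abs_tv {w. \<forall>P\<in>X. w \<tturnstile> P}"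

lemma forces_Inf: "w \<tturnstile> tv_Inf X \<longleftrightarrow> (\<forall>P\<in>X. w \<tturnstile> P)"
  unfolding tv_Inf_def
proof (rule forces_Abs_tv)
  fix w assume h: "\<And>v r. w \<le> v \<Longrightarrow> (\<And>u. v \<le> u \<Longrightarrow> \<forall>P\<in>X. u \<tturnstile> P \<Longrightarrow> prv u r) \<Longrightarrow> prv v r"
  show "\<forall>P\<in>X. w \<tturnstile> P"
  proof (intro ballI forces_local)
    fix P v r assume "P \<in> X" "w \<le> v" and r: "\<And>u. v \<le> u \<Longrightarrow> u \<tturnstile> P \<Longrightarrow> prv u r"
    show "prv v r"
      by (rule h[OF \<open>w \<le> v\<close>], rule r) (use \<open>P \<in> X\<close> in blast)+
  qed
qed (auto intro: forces_mono)

definition tv_imp :: "tv \<Rightarrow> tv \<Rightarrow> tv" (infixr \<open>\<rightarrow>\<^sub>i\<close> 25) where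
  "(P \<rightarrow>\<^sub>i Q) = Abs_tv {w. \<forall>v\<ge>w. v \<tturnstile> P \<longrightarrow> v \<tturnstile> Q}"

lemma forces_imp: "w \<tturnstile> (P \<rightarrow>\<^sub>i Q) \<longleftrightarrow> (\<forall>v\<ge>w. v \<tturnstile> P \<longrightarrow> v \<tturnstile> Q)"
  unfolding tv_imp_def
proof (rule forces_Abs_tv)
  fix w assume h: "\<And>v r. w \<le> v \<Longrightarrow>
    (\<And>u. v \<le> u \<Longrightarrow> \<forall>t\<ge>u. t \<tturnstile> P \<longrightarrow> t \<tturnstile> Q \<Longrightarrow> prv u r) \<Longrightarrow> prv v r"
  show "\<forall>v\<ge>w. v \<tturnstile> P \<longrightarrow> v \<tturnstile> Q"
  proof (intro allI impI)
    fix v assume v: "w \<le> v" "v \<tturnstile> P"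
    show "v \<tturnstile> Q"
    proof (rule forces_local)
      fix u r assume u: "v \<le> u" and r: "\<And>t. u \<le> t \<Longrightarrow> t \<tturnstile> Q \<Longrightarrow> prv t r"
      show "prv u r"
      proof (rule h[OF order.trans[OF v(1) u]], rule r)
        fix t assume t: "u \<le> t" and "\<forall>s\<ge>t. s \<tturnstile> P \<longrightarrow> s \<tturnstile> Q"
        then show "t \<tturnstile> Q"
          using forces_mono[OF v(2) order.trans[OF u t]] by blast
      qed
    qed
  qed
qed (auto intro: order.trans)

definition tv_and :: "tv \<Rightarrow> tv \<Rightarrow> tv" (infixr \<open>\<and>\<^sub>i\<close> 35) where
  "(P \<and>\<^sub>i Q) = tv_Inf {P, Q}"

definition tv_all :: "(nat \<Rightarrow> tv) \<Rightarrow> tv" (binder \<open>\<forall>\<^sub>i\<close> 10) where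
  "(\<forall>\<^sub>i x. P x) = tv_Inf (range P)"

text \<open>Disjunction and existential quantification are encoded by their elimination rules, with \<open>R\<close> ranging over
all truth values. The elimination rules \<open>orE_i\<close> and \<open>exE_i\<close> are then immediate for
every conclusion, composite ones included.\<close>

definition tv_or :: "tv \<Rightarrow> tv \<Rightarrow> tv" (infixr \<open>\<or>\<^sub>i\<close> 30) where
  "(P \<or>\<^sub>i Q) = tv_Inf (range (\<lambda>R. (P \<rightarrow>\<^sub>i R) \<rightarrow>\<^sub>i (Q \<rightarrow>\<^sub>i R) \<rightarrow>\<^sub>i R))"

definition tv_ex :: "(nat \<Rightarrow> tv) \<Rightarrow> tv" (binder \<open>\<exists>\<^sub>i\<close> 10) where
  "(\<exists>\<^sub>i x. P x) = tv_Inf (range (\<lambda>R. (\<forall>\<^sub>i x. P x \<rightarrow>\<^sub>i R) \<rightarrow>\<^sub>i R))"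

definition tv_iff :: "tv \<Rightarrow> tv \<Rightarrow> tv" (infixr \<open>\<leftrightarrow>\<^sub>i\<close> 25) where
  "(P \<leftrightarrow>\<^sub>i Q) = ((P \<rightarrow>\<^sub>i Q) \<and>\<^sub>i (Q \<rightarrow>\<^sub>i P))"

lemma forces_and [simp]: "w \<tturnstile> (P \<and>\<^sub>i Q) \<longleftrightarrow> w \<tturnstile> P \<and> w \<tturnstile> Q"
  by (simp add: tv_and_def forces_Inf)

lemma forces_all [simp]: "w \<tturnstile> (\<forall>\<^sub>i x. P x) \<longleftrightarrow> (\<forall>x. w \<tturnstile> P x)"
  by (simp add: tv_all_def forces_Inf)

lemma forces_iff: "w \<tturnstile> (P \<leftrightarrow>\<^sub>i Q) \<longleftrightarrow> (\<forall>v\<ge>w. v \<tturnstile> P \<longleftrightarrow> v \<tturnstile> Q)"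
  by (auto simp: tv_iff_def forces_imp)

lemma impE_i: "w \<tturnstile> (P \<rightarrow>\<^sub>i Q) \<Longrightarrow> w \<tturnstile> P \<Longrightarrow> w \<tturnstile> Q"
  by (simp add: forces_imp)

lemma iffI_i:
  "(\<And>v. w \<le> v \<Longrightarrow> v \<tturnstile> P \<Longrightarrow> v \<tturnstile> Q) \<Longrightarrow> (\<And>v. w \<le> v \<Longrightarrow> v \<tturnstile> Q \<Longrightarrow> v \<tturnstile> P) \<Longrightarrow> w \<tturnstile> (P \<leftrightarrow>\<^sub>i Q)"
  by (auto simp: forces_iff)

lemma iffD_i: "w \<tturnstile> (P \<leftrightarrow>\<^sub>i Q) \<Longrightarrow> w \<tturnstile> P \<longleftrightarrow> w \<tturnstile> Q"
  by (simp add: forces_iff)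

lemma forces_ex:
  "w \<tturnstile> (\<exists>\<^sub>i x. P x) \<longleftrightarrow> (\<forall>R. \<forall>v\<ge>w. (\<forall>x. \<forall>u\<ge>v. u \<tturnstile> P x \<longrightarrow> u \<tturnstile> R) \<longrightarrow> v \<tturnstile> R)"
  by (simp add: tv_ex_def forces_Inf forces_imp)

lemma forces_or:
  "w \<tturnstile> (P \<or>\<^sub>i Q) \<longleftrightarrow> (\<forall>R. \<forall>v\<ge>w. (\<forall>u\<ge>v. u \<tturnstile> P \<longrightarrow> u \<tturnstile> R) \<longrightarrow>
    (\<forall>u\<ge>v. (\<forall>t\<ge>u. t \<tturnstile> Q \<longrightarrow> t \<tturnstile> R) \<longrightarrow> u \<tturnstile> R))"
  by (simp add: tv_or_def forces_Inf forces_imp)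

lemma exI_i: "w \<tturnstile> P x \<Longrightarrow> w \<tturnstile> (\<exists>\<^sub>i x. P x)"
  unfolding forces_ex by (blast intro: forces_mono)

lemma exE_i:
  assumes "w \<tturnstile> (\<exists>\<^sub>i x. P x)" "\<And>v x. w \<le> v \<Longrightarrow> v \<tturnstile> P x \<Longrightarrow> v \<tturnstile> Q" shows "w \<tturnstile> Q"
  using assms(1)[unfolded forces_ex, rule_format, of w Q] assms(2) by blast

lemma orI1_i: "w \<tturnstile> P \<Longrightarrow> w \<tturnstile> (P \<or>\<^sub>i Q)"
  unfolding forces_or by (meson forces_mono order.trans)

lemma orI2_i: "w \<tturnstile> Q \<Longrightarrow> w \<tturnstile> (P \<or>\<^sub>i Q)"
  unfolding forces_or by (meson forces_mono order.trans order.refl)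

lemma orE_i:
  assumes "w \<tturnstile> (P \<or>\<^sub>i Q)" "\<And>v. w \<le> v \<Longrightarrow> v \<tturnstile> P \<Longrightarrow> v \<tturnstile> R" "\<And>v. w \<le> v \<Longrightarrow> v \<tturnstile> Q \<Longrightarrow> v \<tturnstile> R"
  shows "w \<tturnstile> R"
  using assms(1)[unfolded forces_or, rule_format, of w R w] assms(2,3) by blast

lemma bexE_i:
  assumes "w \<tturnstile> (\<exists>\<^sub>i x. P x \<and>\<^sub>i Q x)" "\<And>v x. w \<le> v \<Longrightarrow> v \<tturnstile> P x \<Longrightarrow> v \<tturnstile> Q x \<Longrightarrow> v \<tturnstile> R"
  shows "w \<tturnstile> R"
  by (rule exE_i[OF assms(1)]) (auto intro: assms(2))

lemma ex_mono_i:
  assumes "w \<tturnstile> (\<exists>\<^sub>i x. P x)" "\<And>v x. w \<le> v \<Longrightarrow> v \<tturnstile> P x \<Longrightarrow> v \<tturnstile> Q x"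
  shows "w \<tturnstile> (\<exists>\<^sub>i x. Q x)"
  by (rule exE_i[OF assms(1)]) (blast intro: exI_i assms(2))

lemma ex_cong_i:
  assumes "\<And>v x. w \<le> v \<Longrightarrow> v \<tturnstile> P x \<longleftrightarrow> v \<tturnstile> Q x"
  shows "w \<tturnstile> (\<exists>\<^sub>i x. P x) \<longleftrightarrow> w \<tturnstile> (\<exists>\<^sub>i x. Q x)"
  using assms by (blast intro: ex_mono_i)

lemma all_iff_at: "w \<tturnstile> (\<forall>\<^sub>i x. P x \<leftrightarrow>\<^sub>i Q x) \<Longrightarrow> w \<le> v \<Longrightarrow> v \<tturnstile> P x \<longleftrightarrow> v \<tturnstile> Q x"
  by (simp add: forces_iff)

lemma exE2_i:
  assumes "w \<tturnstile> (\<exists>\<^sub>i x y. P x y)" "\<And>v x y. w \<le> v \<Longrightarrow> v \<tturnstile> P x y \<Longrightarrow> v \<tturnstile> R"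
  shows "w \<tturnstile> R"
  by (rule exE_i[OF assms(1)], erule exE_i) (blast intro: assms(2) order.trans)

lemma exI2_i: "w \<tturnstile> P x y \<Longrightarrow> w \<tturnstile> (\<exists>\<^sub>i x y. P x y)"
  by (rule exI_i[of _ _ x], rule exI_i[of _ _ y])

lemma exE3_i:
  assumes "w \<tturnstile> (\<exists>\<^sub>i x y z. P x y z)" "\<And>v x y z. w \<le> v \<Longrightarrow> v \<tturnstile> P x y z \<Longrightarrow> v \<tturnstile> R"
  shows "w \<tturnstile> R"
  by (rule exE_i[OF assms(1)], erule exE_i, erule exE_i) (blast intro: assms(2) order.trans)

lemma exI3_i: "w \<tturnstile> P x y z \<Longrightarrow> w \<tturnstile> (\<exists>\<^sub>i x y z. P x y z)"
  by (rule exI_i[of _ _ x], rule exI_i[of _ _ y], rule exI_i[of _ _ z])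

lemma tv_eqI: "(\<And>w. w \<tturnstile> P \<longleftrightarrow> w \<tturnstile> Q) \<Longrightarrow> P = Q"
  by (metis Rep_tv_inject forces_def set_eqI)

lemma tval_And: "tval (And p q) = (tval p \<and>\<^sub>i tval q)"
  by (rule tv_eqI) (auto simp: forces_tval prv_def intro: derives.AndI dest: derives.AndE1 derives.AndE2)

lemma tval_Imp: "tval (Imp p q) = (tval p \<rightarrow>\<^sub>i tval q)"
  by (rule tv_eqI) (simp add: forces_tval prv_Imp forces_imp)

text \<open>From left to right it matters that truth values are closed: a world deriving \<open>Or p q\<close> need derive
neither \<open>p\<close> nor \<open>q\<close>, but each of its extensions by one of them forces the right-hand side, and a formula
that follows in both extensions follows from the disjunction.\<close>

lemma tval_Or: "tval (Or p q) = (tval p \<or>\<^sub>i tval q)"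
proof (rule tv_eqI)
  fix w
  show "w \<tturnstile> tval (Or p q) \<longleftrightarrow> w \<tturnstile> (tval p \<or>\<^sub>i tval q)"
  proof
    assume "w \<tturnstile> tval (Or p q)"
    then have or: "prv w (Or p q)" by (simp add: forces_tval)
    show "w \<tturnstile> (tval p \<or>\<^sub>i tval q)"
    proof (rule forces_local)
      fix v r
      assume v: "w \<le> v" and h: "\<And>u. v \<le> u \<Longrightarrow> u \<tturnstile> (tval p \<or>\<^sub>i tval q) \<Longrightarrow> prv u r"
      have "v \<le> finsert p v" "v \<le> finsert q v" by auto
      then have "prv (finsert p v) r" "prv (finsert q v) r"
        using h orI1_i orI2_i forces_tval prv_assm by metis+
      then show "prv v r"
        using derives.OrE prv_mono[OF or v] unfolding prv_def by fastforce
    qed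
  next
    assume "w \<tturnstile> (tval p \<or>\<^sub>i tval q)"
    then show "w \<tturnstile> tval (Or p q)"
      by (rule orE_i) (auto simp: forces_tval prv_def intro: derives.OrI1 derives.OrI2)
  qed
qed

lemma tval_Forall: "tval (Forall p) = (\<forall>\<^sub>i x. tval (subst0 p x))"
  by (rule tv_eqI) (simp add: forces_tval prv_Forall)

lemma tval_Exists: "tval (Exists p) = (\<exists>\<^sub>i x. tval (subst0 p x))"
proof (rule tv_eqI)
  fix w
  show "w \<tturnstile> tval (Exists p) \<longleftrightarrow> w \<tturnstile> (\<exists>\<^sub>i x. tval (subst0 p x))"
  proof
    assume "w \<tturnstile> tval (Exists p)"
    then have ex: "prv w (Exists p)" by (simp add: forces_tval)
    show "w \<tturnstile> (\<exists>\<^sub>i x. tval (subst0 p x))"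
    proof (rule forces_local)
      fix v r
      assume v: "w \<le> v" and h: "\<And>u. v \<le> u \<Longrightarrow> u \<tturnstile> (\<exists>\<^sub>i x. tval (subst0 p x)) \<Longrightarrow> prv u r"
      show "prv v r"
        by (rule prv_Exists_elim[OF prv_mono[OF ex v]], rule h)
          (auto intro: exI_i simp: forces_tval)
    qed
  next
    assume "w \<tturnstile> (\<exists>\<^sub>i x. tval (subst0 p x))"
    then show "w \<tturnstile> tval (Exists p)"
      by (rule exE_i) (auto simp: forces_tval prv_def intro: derives.ExistsI)
  qed
qed

section \<open>Interpretation of formulas\<close>

definition ev :: "(nat \<Rightarrow> nat) \<Rightarrow> fm \<Rightarrow> tv" where
  "ev e p = tval (ren e p)"

definition mem :: "nat \<Rightarrow> nat \<Rightarrow> tv" (infix \<open>\<epsilon>\<close> 50) where "x \<epsilon> y = tval (Mem x y)"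
definition eq :: "nat \<Rightarrow> nat \<Rightarrow> tv" (infix \<open>\<approx>\<close> 50) where "x \<approx> y = tval (Equal x y)"

lemma subst0_ren_up: "subst0 (ren (0 ## (\<lambda>i. Suc (e i))) p) x = ren (x ## e) p"
  unfolding ren_ren by (rule ren_cong) (auto split: nat.split)

lemma ev_simps [simp]:
  "ev e (Mem i j) = (e i \<epsilon> e j)"
  "ev e (Equal i j) = (e i \<approx> e j)"
  "ev e (And p q) = (ev e p \<and>\<^sub>i ev e q)"
  "ev e (Or p q) = (ev e p \<or>\<^sub>i ev e q)"
  "ev e (Imp p q) = (ev e p \<rightarrow>\<^sub>i ev e q)"
  "ev e (Forall p) = (\<forall>\<^sub>i x. ev (x ## e) p)"
  "ev e (Exists p) = (\<exists>\<^sub>i x. ev (x ## e) p)"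
  by (simp_all add: ev_def mem_def eq_def tval_And tval_Or tval_Imp tval_Forall tval_Exists
      subst0_ren_up)

lemma ev_ren: "ev e (ren s p) = ev (\<lambda>i. e (s i)) p"
  by (simp add: ev_def ren_ren)

lemma derivesI_ev: "{||} \<tturnstile> ev (\<lambda>i. i) p \<Longrightarrow> ECST \<turnstile> p"
  by (simp add: ev_def forces_tval prv_def ren_id)

lemma approx_refl: "w \<tturnstile> x \<approx> x"
  by (simp add: eq_def forces_tval prv_def derives.EqualI)

lemma approx_subst:
  assumes "w \<tturnstile> x \<approx> y" "w \<tturnstile> ev (x ## e) p" shows "w \<tturnstile> ev (y ## e) p"
proof -
  let ?q = "ren (0 ## (\<lambda>i. Suc (e i))) p"
  have "ECST \<union> fset w \<turnstile> subst0 ?q y"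
    by (rule derives.EqualE[where i = x])
      (use assms in \<open>simp_all add: eq_def ev_def forces_tval prv_def subst0_ren_up\<close>)
  then show ?thesis by (simp add: ev_def forces_tval prv_def subst0_ren_up)
qed

section \<open>The axioms of ECST as forced statements\<close>

lemma ECST_forces:
  assumes "p \<in> ECST" shows "w \<tturnstile> ev e p"
  using assms ren_closed[OF ECST_closed[OF assms]]
  by (auto simp: ev_def forces_tval prv_def intro: derives.Assm)

text \<open>Free variables of an axiom scheme are parameters: eliminating the closing quantifiers one by one gives
the scheme in an arbitrary environment.\<close>

lemma ev_Forall_pow: "(\<And>e. w \<tturnstile> ev e ((Forall ^^ k) p)) \<Longrightarrow> w \<tturnstile> ev e p"
proof (induction k arbitrary: e)
  case (Suc k)
  have "w \<tturnstile> ev e ((Forall ^^ k) p)" for e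
  proof -
    have "e = e 0 ## (\<lambda>i. e (Suc i))" by (auto simp: fun_eq_iff split: nat.split)
    moreover have "w \<tturnstile> ev (e 0 ## (\<lambda>i. e (Suc i))) ((Forall ^^ k) p)"
      using Suc.prems[of "\<lambda>i. e (Suc i)"] by simp
    ultimately show ?thesis by simp
  qed
  then show ?case by (rule Suc.IH)
qed simp

lemma universal_closures_forces:
  assumes "universal_closures p \<subseteq> ECST" shows "w \<tturnstile> ev e p"
proof -
  have fv: "fv ((Forall ^^ k) p) = {i. i + k \<in> fv p}" for k
    by (induction k) auto
  obtain k where "\<And>i. i \<in> fv p \<Longrightarrow> i < k"
    using finite_fv[of p] by (meson finite_nat_set_iff_bounded)
  then have "fv ((Forall ^^ k) p) = {}" unfolding fv by fastforce
  then have "(Forall ^^ k) p \<in> ECST" using assms by (auto simp: universal_closures_def)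
  then show ?thesis by - (rule ev_Forall_pow[of w k], rule ECST_forces)
qed

text \<open>Below \<open>n\<close> quantifiers, \<open>inst\<close> takes the listed variables from the bound part of the environment, and the
parameters from the part beyond \<open>n\<close>.\<close>

lemma ev_inst:
  assumes "\<And>i. i < length xs \<Longrightarrow> e (n - Suc (xs ! i)) = s i" "\<And>i. e (n + i) = s (length xs + i)"
  shows "ev e (inst p xs n) = ev s p"
proof -
  have "(\<lambda>i. e (if i < length xs then n - Suc (xs ! i) else n + (i - length xs))) = s"
  proof
    fix i
    show "e (if i < length xs then n - Suc (xs ! i) else n + (i - length xs)) = s i"
      using assms(1)[of i] assms(2)[of "i - length xs"]
      by (cases "i < length xs") (simp_all add: not_less)
  qed
  then show ?thesis by (simp add: inst_def ev_ren)
qed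

lemmas connectives = c_mem_def c_eq_def c_bot_def c_and_def c_or_def c_imp_def c_iff_def
  c_all_def c_ex_def c_ex1_def tv_iff_def[symmetric]

lemma extensionality:
  assumes "w \<tturnstile> (\<forall>\<^sub>i x. x \<epsilon> a \<leftrightarrow>\<^sub>i x \<epsilon> b)" shows "w \<tturnstile> a \<approx> b"
proof -
  have "w \<tturnstile> (\<forall>\<^sub>i a b. (\<forall>\<^sub>i x. x \<epsilon> a \<leftrightarrow>\<^sub>i x \<epsilon> b) \<rightarrow>\<^sub>i a \<approx> b)"
    using ECST_forces[of "ax_extensionality 0" w "\<lambda>i. i"]
    by (simp add: ECST_def ax_extensionality_def connectives)
  then have "w \<tturnstile> ((\<forall>\<^sub>i x. x \<epsilon> a \<leftrightarrow>\<^sub>i x \<epsilon> b) \<rightarrow>\<^sub>i a \<approx> b)" by simp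
  then show ?thesis using assms by (rule impE_i)
qed

lemma ext_of_iff:
  assumes "\<And>v x. w \<le> v \<Longrightarrow> v \<tturnstile> x \<epsilon> a \<longleftrightarrow> v \<tturnstile> x \<epsilon> b" shows "w \<tturnstile> a \<approx> b"
  by (rule extensionality) (simp add: forces_iff assms)

lemma pairing: "w \<tturnstile> (\<exists>\<^sub>i c. \<forall>\<^sub>i x. x \<epsilon> c \<leftrightarrow>\<^sub>i (x \<approx> a \<or>\<^sub>i x \<approx> b))"
  using ECST_forces[of "ax_pairing 0" w "\<lambda>i. i"]
  by (simp add: ECST_def ax_pairing_def connectives)

lemma union: "w \<tturnstile> (\<exists>\<^sub>i b. \<forall>\<^sub>i x. x \<epsilon> b \<leftrightarrow>\<^sub>i (\<exists>\<^sub>i y. y \<epsilon> a \<and>\<^sub>i x \<epsilon> y))"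
  using ECST_forces[of "ax_union 0" w "\<lambda>i. i"]
  by (simp add: ECST_def ax_union_def connectives)

lemma separation:
  assumes "restricted p"
  shows "w \<tturnstile> (\<exists>\<^sub>i b. \<forall>\<^sub>i x. x \<epsilon> b \<leftrightarrow>\<^sub>i (x \<epsilon> a \<and>\<^sub>i ev (x ## a ## e) p))"
proof -
  have "universal_closures (ax_separation p 0) \<subseteq> ECST"
    unfolding ECST_def using assms by blast
  then have "w \<tturnstile> ev e (ax_separation p 0)" by (rule universal_closures_forces)
  moreover have "ev (x ## b ## a ## e) (inst p [Suc (Suc 0), 0] (Suc (Suc (Suc 0)))) =
      ev (x ## a ## e) p" for x b a
    by (rule ev_inst) (auto simp: nth_Cons less_Suc_eq numeral_3_eq_3 split: nat.split)
  ultimately show ?thesis by (simp add: ax_separation_def connectives)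
qed

lemma replacement:
  assumes "\<And>v x. w \<le> v \<Longrightarrow> v \<tturnstile> x \<epsilon> a \<Longrightarrow>
    v \<tturnstile> (\<exists>\<^sub>i y. ev (x ## y ## a ## e) p \<and>\<^sub>i (\<forall>\<^sub>i z. ev (x ## z ## a ## e) p \<rightarrow>\<^sub>i z \<approx> y))"
  shows "w \<tturnstile> (\<exists>\<^sub>i b. \<forall>\<^sub>i y. y \<epsilon> b \<leftrightarrow>\<^sub>i (\<exists>\<^sub>i x. x \<epsilon> a \<and>\<^sub>i ev (x ## y ## a ## e) p))"
proof -
  have "universal_closures (ax_replacement p 0) \<subseteq> ECST"
    unfolding ECST_def by blast
  then have "w \<tturnstile> ev e (ax_replacement p 0)" by (rule universal_closures_forces)
  moreover have
    "ev (y ## x ## a ## e) (inst p [Suc 0, Suc (Suc 0), 0] (Suc (Suc (Suc 0)))) = ev (x ## y ## a ## e) p"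
    "ev (z ## y ## x ## a ## e) (inst p [Suc 0, Suc (Suc (Suc 0)), 0] (Suc (Suc (Suc (Suc 0))))) =
      ev (x ## z ## a ## e) p"
    "ev (x ## y ## b ## a ## e) (inst p [Suc (Suc (Suc 0)), Suc (Suc 0), 0] (Suc (Suc (Suc (Suc 0))))) =
      ev (x ## y ## a ## e) p" for x y z a b
    by (rule ev_inst; auto simp: nth_Cons less_Suc_eq split: nat.split)+
  ultimately have "w \<tturnstile> ((\<forall>\<^sub>i x. x \<epsilon> a \<rightarrow>\<^sub>i (\<exists>\<^sub>i y. ev (x ## y ## a ## e) p \<and>\<^sub>i
        (\<forall>\<^sub>i z. ev (x ## z ## a ## e) p \<rightarrow>\<^sub>i z \<approx> y))) \<rightarrow>\<^sub>i
      (\<exists>\<^sub>i b. \<forall>\<^sub>i y. y \<epsilon> b \<leftrightarrow>\<^sub>i (\<exists>\<^sub>i x. x \<epsilon> a \<and>\<^sub>i ev (x ## y ## a ## e) p)))"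
    by (simp add: ax_replacement_def connectives)
  then show ?thesis by (rule impE_i) (simp add: forces_imp assms)
qed

section \<open>Sets and ordered pairs\<close>

text \<open>Most predicates with capital initials are the truth values of formulas of the same meaning. A formula
whose variables are levels below \<open>n\<close> is evaluated by looking up the level \<open>i\<close> at index \<open>n - Suc i\<close>; the
evaluation lemmas carry out this translation once and for all depths.\<close>

definition Sub :: "nat \<Rightarrow> nat \<Rightarrow> tv" where
  "Sub a b = (\<forall>\<^sub>i z. z \<epsilon> a \<rightarrow>\<^sub>i z \<epsilon> b)"

definition Upair :: "nat \<Rightarrow> nat \<Rightarrow> nat \<Rightarrow> tv" where
  "Upair z x y = (x \<epsilon> z \<and>\<^sub>i y \<epsilon> z \<and>\<^sub>i (\<forall>\<^sub>i t. t \<epsilon> z \<rightarrow>\<^sub>i (t \<approx> x \<or>\<^sub>i t \<approx> y)))"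

definition Opair :: "nat \<Rightarrow> nat \<Rightarrow> nat \<Rightarrow> tv" where
  "Opair p x y =
    (\<exists>\<^sub>i u. u \<epsilon> p \<and>\<^sub>i (\<exists>\<^sub>i v. v \<epsilon> p \<and>\<^sub>i Upair u x x \<and>\<^sub>i Upair v x y \<and>\<^sub>i Upair p u v))"

definition Related :: "nat \<Rightarrow> nat \<Rightarrow> nat \<Rightarrow> tv" where
  "Related f x y = (\<exists>\<^sub>i p. p \<epsilon> f \<and>\<^sub>i Opair p x y)"

lemma lookup: "i < n \<Longrightarrow> (z ## e) (n - i) = e (n - Suc i)"
  by (simp add: Suc_diff_Suc[symmetric])

lemma ev_subset: "i < n \<Longrightarrow> j < n \<Longrightarrow> ev e ((i \<^bold>\<subseteq> j) n) = Sub (e (n - Suc i)) (e (n - Suc j))"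
  by (simp add: c_subset_def connectives Sub_def lookup)

lemma ev_upair:
  "i < n \<Longrightarrow> j < n \<Longrightarrow> k < n \<Longrightarrow>
    ev e (is_upair i j k n) = Upair (e (n - Suc i)) (e (n - Suc j)) (e (n - Suc k))"
  by (simp add: is_upair_def connectives Upair_def lookup)

lemma ev_pair:
  "i < n \<Longrightarrow> j < n \<Longrightarrow> k < n \<Longrightarrow>
    ev e (is_pair i j k n) = Opair (e (n - Suc i)) (e (n - Suc j)) (e (n - Suc k))"
  by (simp add: is_pair_def connectives Opair_def ev_upair lookup Suc_diff_le)

lemma ev_related:
  "i < n \<Longrightarrow> j < n \<Longrightarrow> k < n \<Longrightarrow>
    ev e (related i j k n) = Related (e (n - Suc i)) (e (n - Suc j)) (e (n - Suc k))"
  by (simp add: related_def connectives Related_def ev_pair lookup Suc_diff_le)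

lemma restricted_bex: "0 < j \<Longrightarrow> restricted p \<Longrightarrow> restricted (Exists (And (Mem 0 j) p))"
  by (cases j) (auto intro: restricted.intros)

lemma restricted_ball: "0 < j \<Longrightarrow> restricted p \<Longrightarrow> restricted (Forall (Imp (Mem 0 j) p))"
  by (cases j) (auto intro: restricted.intros)

lemmas restrictedI = restricted_bex restricted_ball restricted.intros(1-6)

lemma restricted_pair: "i < n \<Longrightarrow> restricted (is_pair i j k n)"
  unfolding is_pair_def is_upair_def connectives diff_self_eq_0 by (intro restrictedI) simp_all

lemma restricted_related: "i < n \<Longrightarrow> restricted (related i j k n)"
  unfolding related_def connectives diff_self_eq_0 by (intro restrictedI restricted_pair) simp_all

lemma mem_cong_left: "w \<tturnstile> x \<approx> y \<Longrightarrow> w \<tturnstile> x \<epsilon> a \<Longrightarrow> w \<tturnstile> y \<epsilon> a"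
  using approx_subst[of w x y "a ## id" "Mem 0 1"] by simp

lemma mem_cong_right: "w \<tturnstile> a \<approx> b \<Longrightarrow> w \<tturnstile> x \<epsilon> a \<Longrightarrow> w \<tturnstile> x \<epsilon> b"
  using approx_subst[of w a b "x ## id" "Mem 1 0"] by simp

lemma approx_sym: "w \<tturnstile> x \<approx> y \<Longrightarrow> w \<tturnstile> y \<approx> x"
  using approx_subst[of w x y "x ## id" "Equal 0 1"] by (simp add: approx_refl)

lemma approx_trans: "w \<tturnstile> x \<approx> y \<Longrightarrow> w \<tturnstile> y \<approx> z \<Longrightarrow> w \<tturnstile> x \<approx> z"
  using approx_subst[of w y z "x ## id" "Equal 1 0"] by simp

lemma Upair_cong: "w \<tturnstile> z \<approx> z' \<Longrightarrow> w \<tturnstile> Upair z x y \<Longrightarrow> w \<tturnstile> Upair z' x y"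
  using approx_subst[of w z z' "x ## y ## id" "is_upair 2 1 0 3"]
  by (simp add: ev_upair numeral_2_eq_2 numeral_3_eq_3)

lemma Upair_cong_elems:
  "w \<tturnstile> x \<approx> x' \<Longrightarrow> w \<tturnstile> y \<approx> y' \<Longrightarrow> w \<tturnstile> Upair p x y \<Longrightarrow> w \<tturnstile> Upair p x' y'"
  using approx_subst[of w x x' "y ## p ## id" "is_upair 0 2 1 3"]
    approx_subst[of w y y' "x' ## p ## id" "is_upair 0 1 2 3"]
  by (simp add: ev_upair numeral_2_eq_2 numeral_3_eq_3)

lemma Opair_cong:
  "w \<tturnstile> x \<approx> x' \<Longrightarrow> w \<tturnstile> y \<approx> y' \<Longrightarrow> w \<tturnstile> Opair p x y \<Longrightarrow> w \<tturnstile> Opair p x' y'"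
  using approx_subst[of w x x' "y ## p ## id" "is_pair 0 2 1 3"]
    approx_subst[of w y y' "x' ## p ## id" "is_pair 0 1 2 3"]
  by (simp add: ev_pair numeral_2_eq_2 numeral_3_eq_3)

lemma Related_cong:
  "w \<tturnstile> x \<approx> x' \<Longrightarrow> w \<tturnstile> y \<approx> y' \<Longrightarrow> w \<tturnstile> Related p x y \<Longrightarrow> w \<tturnstile> Related p x' y'"
  using approx_subst[of w x x' "y ## p ## id" "related 0 2 1 3"]
    approx_subst[of w y y' "x' ## p ## id" "related 0 1 2 3"]
  by (simp add: ev_related numeral_2_eq_2 numeral_3_eq_3)

lemma Upair_iff: "w \<tturnstile> Upair z x y \<longleftrightarrow> w \<tturnstile> (\<forall>\<^sub>i t. t \<epsilon> z \<leftrightarrow>\<^sub>i (t \<approx> x \<or>\<^sub>i t \<approx> y))"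
proof
  assume a: "w \<tturnstile> Upair z x y"
  have "v \<tturnstile> t \<epsilon> z" if v: "w \<le> v" and o: "v \<tturnstile> (t \<approx> x \<or>\<^sub>i t \<approx> y)" for v t
    using o
  proof (rule orE_i)
    fix u assume u: "v \<le> u"
    have "u \<tturnstile> x \<epsilon> z" "u \<tturnstile> y \<epsilon> z"
      using forces_mono[OF a order.trans[OF v u]] by (simp_all add: Upair_def)
    then show "u \<tturnstile> t \<approx> x \<Longrightarrow> u \<tturnstile> t \<epsilon> z" "u \<tturnstile> t \<approx> y \<Longrightarrow> u \<tturnstile> t \<epsilon> z"
      by (auto intro: mem_cong_left approx_sym)
  qed
  then show "w \<tturnstile> (\<forall>\<^sub>i t. t \<epsilon> z \<leftrightarrow>\<^sub>i (t \<approx> x \<or>\<^sub>i t \<approx> y))"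
    using a by (auto simp: Upair_def forces_imp forces_iff)
next
  assume "w \<tturnstile> (\<forall>\<^sub>i t. t \<epsilon> z \<leftrightarrow>\<^sub>i (t \<approx> x \<or>\<^sub>i t \<approx> y))"
  then show "w \<tturnstile> Upair z x y"
    by (auto simp: Upair_def forces_imp forces_iff intro: orI1_i orI2_i approx_refl)
qed

lemma Upair_mem: "w \<tturnstile> Upair z x y \<Longrightarrow> w \<tturnstile> t \<epsilon> z \<Longrightarrow> w \<tturnstile> (t \<approx> x \<or>\<^sub>i t \<approx> y)"
  by (simp add: Upair_iff forces_iff)

lemma ex_Upair: "w \<tturnstile> (\<exists>\<^sub>i z. Upair z x y)"
  by (rule exE_i[OF pairing[of w x y]]) (metis exI_i Upair_iff)

lemma Upair_unique: "w \<tturnstile> Upair z x y \<Longrightarrow> w \<tturnstile> Upair z' x y \<Longrightarrow> w \<tturnstile> z \<approx> z'"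
  by (rule ext_of_iff) (simp add: Upair_iff forces_iff)

text \<open>Each of the four elements lies in both presentations of \<open>z\<close>. Deciding first which of \<open>a, b\<close> equals \<open>x\<close>, then
where the other one lies, and finally, if that is still open, where \<open>y\<close> lies, exhausts the cases constructively: at no stage is a
case distinction on the equality of two arbitrary sets required.\<close>

lemma Upair_inj:
  assumes "w \<tturnstile> Upair z x y" "w \<tturnstile> Upair z a b"
  shows "w \<tturnstile> (x \<approx> a \<and>\<^sub>i y \<approx> b \<or>\<^sub>i x \<approx> b \<and>\<^sub>i y \<approx> a)"
proof -
  have mem: "w \<tturnstile> x \<epsilon> z" "w \<tturnstile> y \<epsilon> z" "w \<tturnstile> a \<epsilon> z" "w \<tturnstile> b \<epsilon> z"
    using assms by (simp_all add: Upair_def)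
  note x = Upair_mem[OF assms(2) mem(1)] and y = Upair_mem[OF assms(2) mem(2)]
    and a = Upair_mem[OF assms(1) mem(3)] and b = Upair_mem[OF assms(1) mem(4)]
  show ?thesis
  proof (rule orE_i[OF x])
    fix v assume v: "w \<le> v" "v \<tturnstile> x \<approx> a"
    show "v \<tturnstile> (x \<approx> a \<and>\<^sub>i y \<approx> b \<or>\<^sub>i x \<approx> b \<and>\<^sub>i y \<approx> a)"
    proof (rule orE_i[OF forces_mono[OF b v(1)]])
      fix u assume u: "v \<le> u" "u \<tturnstile> b \<approx> x"
      show "u \<tturnstile> (x \<approx> a \<and>\<^sub>i y \<approx> b \<or>\<^sub>i x \<approx> b \<and>\<^sub>i y \<approx> a)"
      proof (rule orE_i[OF forces_mono[OF y order.trans[OF v(1) u(1)]]])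
        fix t assume t: "u \<le> t"
        note eqs = forces_mono[OF v(2) order.trans[OF u(1) t]] forces_mono[OF u(2) t]
        show "t \<tturnstile> y \<approx> a \<Longrightarrow> t \<tturnstile> (x \<approx> a \<and>\<^sub>i y \<approx> b \<or>\<^sub>i x \<approx> b \<and>\<^sub>i y \<approx> a)"
          by (rule orI2_i) (auto intro: approx_sym eqs)
        show "t \<tturnstile> y \<approx> b \<Longrightarrow> t \<tturnstile> (x \<approx> a \<and>\<^sub>i y \<approx> b \<or>\<^sub>i x \<approx> b \<and>\<^sub>i y \<approx> a)"
          by (rule orI1_i) (auto intro: approx_sym eqs)
      qed
    next
      fix u assume u: "v \<le> u" "u \<tturnstile> b \<approx> y"
      show "u \<tturnstile> (x \<approx> a \<and>\<^sub>i y \<approx> b \<or>\<^sub>i x \<approx> b \<and>\<^sub>i y \<approx> a)"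
        by (rule orI1_i) (use u forces_mono[OF v(2) u(1)] in \<open>simp add: approx_sym\<close>)
    qed
  next
    fix v assume v: "w \<le> v" "v \<tturnstile> x \<approx> b"
    show "v \<tturnstile> (x \<approx> a \<and>\<^sub>i y \<approx> b \<or>\<^sub>i x \<approx> b \<and>\<^sub>i y \<approx> a)"
    proof (rule orE_i[OF forces_mono[OF a v(1)]])
      fix u assume u: "v \<le> u" "u \<tturnstile> a \<approx> x"
      show "u \<tturnstile> (x \<approx> a \<and>\<^sub>i y \<approx> b \<or>\<^sub>i x \<approx> b \<and>\<^sub>i y \<approx> a)"
      proof (rule orE_i[OF forces_mono[OF y order.trans[OF v(1) u(1)]]])
        fix t assume t: "u \<le> t"
        note eqs = forces_mono[OF v(2) order.trans[OF u(1) t]] forces_mono[OF u(2) t]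
        show "t \<tturnstile> y \<approx> a \<Longrightarrow> t \<tturnstile> (x \<approx> a \<and>\<^sub>i y \<approx> b \<or>\<^sub>i x \<approx> b \<and>\<^sub>i y \<approx> a)"
          by (rule orI2_i) (auto intro: approx_sym eqs)
        show "t \<tturnstile> y \<approx> b \<Longrightarrow> t \<tturnstile> (x \<approx> a \<and>\<^sub>i y \<approx> b \<or>\<^sub>i x \<approx> b \<and>\<^sub>i y \<approx> a)"
          by (rule orI1_i) (auto intro: approx_sym eqs)
      qed
    next
      fix u assume u: "v \<le> u" "u \<tturnstile> a \<approx> y"
      show "u \<tturnstile> (x \<approx> a \<and>\<^sub>i y \<approx> b \<or>\<^sub>i x \<approx> b \<and>\<^sub>i y \<approx> a)"
        by (rule orI2_i) (use u forces_mono[OF v(2) u(1)] in \<open>simp add: approx_sym\<close>)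
    qed
  qed
qed

lemma OpairE:
  assumes "w \<tturnstile> Opair p x y"
    and "\<And>v s t. w \<le> v \<Longrightarrow> v \<tturnstile> Upair s x x \<Longrightarrow> v \<tturnstile> Upair t x y \<Longrightarrow> v \<tturnstile> Upair p s t \<Longrightarrow> v \<tturnstile> Q"
  shows "w \<tturnstile> Q"
proof (rule exE_i[OF assms(1)[unfolded Opair_def]])
  fix v s
  assume v: "w \<le> v" and s: "v \<tturnstile> (s \<epsilon> p \<and>\<^sub>i
    (\<exists>\<^sub>i t. t \<epsilon> p \<and>\<^sub>i Upair s x x \<and>\<^sub>i Upair t x y \<and>\<^sub>i Upair p s t))"
  then have "v \<tturnstile> (\<exists>\<^sub>i t. t \<epsilon> p \<and>\<^sub>i Upair s x x \<and>\<^sub>i Upair t x y \<and>\<^sub>i Upair p s t)" by simp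
  then show "v \<tturnstile> Q"
    by (rule exE_i) (use assms(2) v in \<open>auto intro: order.trans\<close>)
qed

lemma OpairI:
  "w \<tturnstile> Upair s x x \<Longrightarrow> w \<tturnstile> Upair t x y \<Longrightarrow> w \<tturnstile> Upair p s t \<Longrightarrow> w \<tturnstile> Opair p x y"
  unfolding Opair_def
  by (rule exI_i[of _ _ s], simp, intro conjI exI_i[of _ _ t]) (simp_all add: Upair_def)

lemma ex_Opair: "w \<tturnstile> (\<exists>\<^sub>i p. Opair p x y)"
proof (rule exE_i[OF ex_Upair[of w x x]])
  fix v s assume v: "w \<le> v" "v \<tturnstile> Upair s x x"
  show "v \<tturnstile> (\<exists>\<^sub>i p. Opair p x y)"
  proof (rule exE_i[OF ex_Upair[of v x y]])
    fix u t assume u: "v \<le> u" "u \<tturnstile> Upair t x y"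
    show "u \<tturnstile> (\<exists>\<^sub>i p. Opair p x y)"
    proof (rule exE_i[OF ex_Upair[of u s t]])
      fix r p assume r: "u \<le> r" "r \<tturnstile> Upair p s t"
      have "r \<tturnstile> Opair p x y"
        by (rule OpairI[OF _ _ r(2)]) (use u v r in \<open>blast intro: forces_mono order.trans\<close>)+
      then show "r \<tturnstile> (\<exists>\<^sub>i p. Opair p x y)" by (rule exI_i)
    qed
  qed
qed

lemma Opair_unique:
  assumes "w \<tturnstile> Opair p x y" "w \<tturnstile> Opair q x y" shows "w \<tturnstile> p \<approx> q"
proof (rule OpairE[OF assms(1)])
  fix v s t assume v: "w \<le> v" "v \<tturnstile> Upair s x x" "v \<tturnstile> Upair t x y" "v \<tturnstile> Upair p s t"
  show "v \<tturnstile> p \<approx> q"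
  proof (rule OpairE[OF forces_mono[OF assms(2) v(1)]])
    fix u s' t'
    assume u: "v \<le> u" "u \<tturnstile> Upair s' x x" "u \<tturnstile> Upair t' x y" "u \<tturnstile> Upair q s' t'"
    note v' = v(2-4)[THEN forces_mono, OF u(1)]
    have "u \<tturnstile> Upair q s t"
      using u(4) Upair_unique[OF u(2) v'(1)] Upair_unique[OF u(3) v'(2)]
      by (blast intro: Upair_cong_elems)
    then show "u \<tturnstile> p \<approx> q" using v'(3) by (blast intro: Upair_unique)
  qed
qed

lemma Upair_singleton:
  assumes "w \<tturnstile> Upair z x x" "w \<tturnstile> Upair z a b" shows "w \<tturnstile> x \<approx> a" "w \<tturnstile> x \<approx> b"
  by (rule orE_i[OF Upair_inj[OF assms]]; simp)+

text \<open>By \<open>Upair_inj\<close> the components \<open>{x}\<close> and \<open>{x, y}\<close> match \<open>{a}\<close> and \<open>{a, b}\<close> either in order or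
crosswise. In the crosswise case both pairs degenerate, and all four elements are equal.\<close>

lemma Opair_inj:
  assumes "w \<tturnstile> Opair p x y" "w \<tturnstile> Opair p a b" shows "w \<tturnstile> (x \<approx> a \<and>\<^sub>i y \<approx> b)"
proof (rule OpairE[OF assms(1)])
  fix v s t assume v: "w \<le> v" "v \<tturnstile> Upair s x x" "v \<tturnstile> Upair t x y" "v \<tturnstile> Upair p s t"
  show "v \<tturnstile> (x \<approx> a \<and>\<^sub>i y \<approx> b)"
  proof (rule OpairE[OF forces_mono[OF assms(2) v(1)]])
    fix u s' t'
    assume u: "v \<le> u" "u \<tturnstile> Upair s' a a" "u \<tturnstile> Upair t' a b" "u \<tturnstile> Upair p s' t'"
    note v' = v(2-4)[THEN forces_mono, OF u(1)]
    show "u \<tturnstile> (x \<approx> a \<and>\<^sub>i y \<approx> b)"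
    proof (rule orE_i[OF Upair_inj[OF v'(3) u(4)]])
      fix r assume r: "u \<le> r" "r \<tturnstile> (s \<approx> s' \<and>\<^sub>i t \<approx> t')"
      note f = v'[THEN forces_mono, OF r(1)] u(2-4)[THEN forces_mono, OF r(1)]
      have s: "r \<tturnstile> Upair s a a" and t: "r \<tturnstile> Upair t a b"
        using r(2) f by (auto intro: Upair_cong approx_sym)
      have x: "r \<tturnstile> x \<approx> a" by (rule Upair_singleton[OF f(1) s])
      have y: "r \<tturnstile> y \<approx> b"
      proof (rule orE_i[OF Upair_inj[OF f(2) t]])
        fix r' assume r': "r \<le> r'" "r' \<tturnstile> (x \<approx> b \<and>\<^sub>i y \<approx> a)"
        then show "r' \<tturnstile> y \<approx> b"
          using forces_mono[OF x r'(1)] by simp (metis approx_trans approx_sym)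
      qed simp
      show "r \<tturnstile> (x \<approx> a \<and>\<^sub>i y \<approx> b)" using x y by simp
    next
      fix r assume r: "u \<le> r" "r \<tturnstile> (s \<approx> t' \<and>\<^sub>i t \<approx> s')"
      note f = v'[THEN forces_mono, OF r(1)] u(2-4)[THEN forces_mono, OF r(1)]
      have s: "r \<tturnstile> Upair s a b" and t: "r \<tturnstile> Upair t a a"
        using r(2) f by (auto intro: Upair_cong approx_sym)
      have x: "r \<tturnstile> x \<approx> a" "r \<tturnstile> x \<approx> b" by (rule Upair_singleton[OF f(1) s])+
      have "r \<tturnstile> a \<approx> y" by (rule Upair_singleton[OF t f(2)])
      then show "r \<tturnstile> (x \<approx> a \<and>\<^sub>i y \<approx> b)" using x by simp (metis approx_trans approx_sym)
    qed
  qed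
qed


section \<open>Relations and their composition\<close>

definition Hom :: "nat \<Rightarrow> nat \<Rightarrow> nat \<Rightarrow> tv" where
  "Hom f A B = (\<forall>\<^sub>i p. p \<epsilon> f \<rightarrow>\<^sub>i (\<exists>\<^sub>i x. x \<epsilon> A \<and>\<^sub>i (\<exists>\<^sub>i y. y \<epsilon> B \<and>\<^sub>i Opair p x y)))"

definition Comp :: "nat \<Rightarrow> nat \<Rightarrow> nat \<Rightarrow> tv" where
  "Comp k g f =
    (\<forall>\<^sub>i p. p \<epsilon> k \<leftrightarrow>\<^sub>i (\<exists>\<^sub>i x y z. Opair p x z \<and>\<^sub>i Related f x y \<and>\<^sub>i Related g y z))"

lemma RelatedI: "w \<tturnstile> p \<epsilon> f \<Longrightarrow> w \<tturnstile> Opair p x y \<Longrightarrow> w \<tturnstile> Related f x y"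
  unfolding Related_def by (rule exI_i[of _ _ p]) simp

lemma Hom_Related:
  assumes "w \<tturnstile> Hom f A B" "w \<tturnstile> Related f x y" shows "w \<tturnstile> x \<epsilon> A" "w \<tturnstile> y \<epsilon> B"
proof -
  have "w \<tturnstile> (x \<epsilon> A \<and>\<^sub>i y \<epsilon> B)"
  proof (rule bexE_i[OF assms(2)[unfolded Related_def]])
    fix v p assume v: "w \<le> v" "v \<tturnstile> p \<epsilon> f" "v \<tturnstile> Opair p x y"
    have "v \<tturnstile> (\<exists>\<^sub>i x. x \<epsilon> A \<and>\<^sub>i (\<exists>\<^sub>i y. y \<epsilon> B \<and>\<^sub>i Opair p x y))"
      using assms(1) v by (simp add: Hom_def forces_imp)
    then show "v \<tturnstile> (x \<epsilon> A \<and>\<^sub>i y \<epsilon> B)"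
    proof (rule bexE_i)
      fix u x' assume u: "v \<le> u" "u \<tturnstile> x' \<epsilon> A" "u \<tturnstile> (\<exists>\<^sub>i y. y \<epsilon> B \<and>\<^sub>i Opair p x' y)"
      show "u \<tturnstile> (x \<epsilon> A \<and>\<^sub>i y \<epsilon> B)"
      proof (rule bexE_i[OF u(3)])
        fix t y' assume t: "u \<le> t" "t \<tturnstile> y' \<epsilon> B" "t \<tturnstile> Opair p x' y'"
        have "t \<tturnstile> (x' \<approx> x \<and>\<^sub>i y' \<approx> y)"
          using t(3) forces_mono[OF v(3) order.trans[OF u(1) t(1)]] by (rule Opair_inj)
        then show "t \<tturnstile> (x \<epsilon> A \<and>\<^sub>i y \<epsilon> B)"
          using t(2) forces_mono[OF u(2) t(1)] by (auto intro: mem_cong_left)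
      qed
    qed
  qed
  then show "w \<tturnstile> x \<epsilon> A" "w \<tturnstile> y \<epsilon> B" by simp_all
qed

lemma ex1_Opair: "w \<tturnstile> (\<exists>\<^sub>i p. Opair p x y \<and>\<^sub>i (\<forall>\<^sub>i q. Opair q x y \<rightarrow>\<^sub>i q \<approx> p))"
  by (rule ex_mono_i[OF ex_Opair]) (auto simp: forces_imp intro: Opair_unique forces_mono)

text \<open>The part of the relation over a fixed \<open>x\<close>: separation selects the suitable \<open>y\<close>, and replacement turns them
into pairs.\<close>

lemma ex_slice:
  assumes "restricted \<phi>"
  shows "w \<tturnstile> (\<exists>\<^sub>i q. \<forall>\<^sub>i p. p \<epsilon> q \<leftrightarrow>\<^sub>i (\<exists>\<^sub>i y. y \<epsilon> B \<and>\<^sub>i ev (y ## x ## e) \<phi> \<and>\<^sub>i Opair p x y))"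
proof -
  \<comment> \<open>the separating formula sees \<open>y, B, x, e\<close> where \<open>\<phi>\<close> expects \<open>y, x, e\<close>\<close>
  let ?s = "0 ## Suc (Suc 0) ## (\<lambda>i. Suc (Suc (Suc i)))"
  have env: "(\<lambda>i. (y ## B ## x ## e) (?s i)) = y ## x ## e" for y
    by (auto simp: fun_eq_iff split: nat.split)
  have pair: "ev (y ## p ## b ## x ## e) (is_pair 2 0 3 4) = Opair p x y" for y p b
    by (simp add: ev_pair eval_nat_numeral)
  have "w \<tturnstile> (\<exists>\<^sub>i b. \<forall>\<^sub>i y. y \<epsilon> b \<leftrightarrow>\<^sub>i (y \<epsilon> B \<and>\<^sub>i ev (y ## x ## e) \<phi>))"
    using separation[OF restricted_ren[OF assms], of w B "x ## e" ?s] by (simp add: ev_ren env)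
  then show ?thesis
  proof (rule exE_i)
    fix v b assume v: "w \<le> v" and b: "v \<tturnstile> (\<forall>\<^sub>i y. y \<epsilon> b \<leftrightarrow>\<^sub>i (y \<epsilon> B \<and>\<^sub>i ev (y ## x ## e) \<phi>))"
    have "v \<tturnstile> (\<exists>\<^sub>i q. \<forall>\<^sub>i p. p \<epsilon> q \<leftrightarrow>\<^sub>i (\<exists>\<^sub>i y. y \<epsilon> b \<and>\<^sub>i Opair p x y))"
      using replacement[of v b "x ## e" "is_pair 2 0 3 4"] by (simp add: pair ex1_Opair)
    then show "v \<tturnstile> (\<exists>\<^sub>i q. \<forall>\<^sub>i p. p \<epsilon> q \<leftrightarrow>\<^sub>i (\<exists>\<^sub>i y. y \<epsilon> B \<and>\<^sub>i ev (y ## x ## e) \<phi> \<and>\<^sub>i Opair p x y))"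
    proof (rule ex_mono_i)
      fix u q assume u: "v \<le> u" and q: "u \<tturnstile> (\<forall>\<^sub>i p. p \<epsilon> q \<leftrightarrow>\<^sub>i (\<exists>\<^sub>i y. y \<epsilon> b \<and>\<^sub>i Opair p x y))"
      have "t \<tturnstile> p \<epsilon> q \<longleftrightarrow> t \<tturnstile> (\<exists>\<^sub>i y. y \<epsilon> B \<and>\<^sub>i ev (y ## x ## e) \<phi> \<and>\<^sub>i Opair p x y)"
        if t: "u \<le> t" for t p
        unfolding all_iff_at[OF q t]
      proof (rule ex_cong_i)
        fix s y assume "t \<le> s"
        then have "v \<le> s" using u t by (blast intro: order.trans)
        then show "s \<tturnstile> (y \<epsilon> b \<and>\<^sub>i Opair p x y) \<longleftrightarrow>
            s \<tturnstile> (y \<epsilon> B \<and>\<^sub>i ev (y ## x ## e) \<phi> \<and>\<^sub>i Opair p x y)"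
          using all_iff_at[OF b] by auto
      qed
      then show "u \<tturnstile> (\<forall>\<^sub>i p. p \<epsilon> q \<leftrightarrow>\<^sub>i (\<exists>\<^sub>i y. y \<epsilon> B \<and>\<^sub>i ev (y ## x ## e) \<phi> \<and>\<^sub>i Opair p x y))"
        by (simp add: forces_iff)
    qed
  qed
qed

text \<open>The source of all relations below. The slices are collected by replacement, which applies because
each slice is determined by extensionality, and their union is the relation. Restrictedness of \<open>\<phi>\<close>
enters through the separation in \<open>ex_slice\<close>; the formula that defines a slice has an unbounded
quantifier, which replacement permits.\<close>

lemma relation_comprehension:
  assumes "restricted \<phi>"
  shows "w \<tturnstile> (\<exists>\<^sub>i F. Hom F A B \<and>\<^sub>i
    (\<forall>\<^sub>i x y. Related F x y \<leftrightarrow>\<^sub>i (x \<epsilon> A \<and>\<^sub>i y \<epsilon> B \<and>\<^sub>i ev (y ## x ## e) \<phi>)))"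
proof -
  define Inner where "Inner p x = (\<exists>\<^sub>i y. y \<epsilon> B \<and>\<^sub>i ev (y ## x ## e) \<phi> \<and>\<^sub>i Opair p x y)" for p x
  define Slice where "Slice x q = (\<forall>\<^sub>i p. p \<epsilon> q \<leftrightarrow>\<^sub>i Inner p x)" for x q
  \<comment> \<open>\<open>?\<psi>\<close> defines \<open>Slice\<close> in the environment \<open>x, q, A, B, e\<close>; \<open>\<phi>\<close> occurs below the quantifiers over \<open>p\<close> and \<open>y\<close>\<close>
  let ?s = "0 ## Suc (Suc 0) ## (\<lambda>i. Suc (Suc (Suc (Suc (Suc (Suc i))))))"
  let ?m = "Exists (And (Mem 0 5) (And (ren ?s \<phi>) (is_pair 1 0 2 3)))"
  let ?\<psi> = "Forall (And (Imp (Mem 0 2) ?m) (Imp ?m (Mem 0 2)))"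
  have env: "(\<lambda>i. (y ## p ## x ## q ## A ## B ## e) (?s i)) = y ## x ## e" for y p x q
    by (auto simp: fun_eq_iff split: nat.split)
  have \<psi>: "ev (x ## q ## A ## B ## e) ?\<psi> = Slice x q" for x q
    by (simp add: ev_ren env ev_pair eval_nat_numeral Slice_def Inner_def tv_iff_def)
  have slice: "v \<tturnstile> (\<exists>\<^sub>i q. Slice x q)" for v x
    using ex_slice[OF assms] by (simp add: Slice_def Inner_def)
  have "v \<tturnstile> (\<exists>\<^sub>i q. Slice x q \<and>\<^sub>i (\<forall>\<^sub>i r. Slice x r \<rightarrow>\<^sub>i r \<approx> q))" for v x
  proof (rule ex_mono_i[OF slice[of v x]])
    fix u q assume q: "u \<tturnstile> Slice x q"
    have "t \<tturnstile> r \<approx> q" if "u \<le> t" "t \<tturnstile> Slice x r" for t r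
      by (rule ext_of_iff) (use q that in \<open>simp add: Slice_def forces_iff\<close>)
    then show "u \<tturnstile> (Slice x q \<and>\<^sub>i (\<forall>\<^sub>i r. Slice x r \<rightarrow>\<^sub>i r \<approx> q))"
      using q by (simp add: forces_imp)
  qed
  then have "w \<tturnstile> (\<exists>\<^sub>i Q. \<forall>\<^sub>i q. q \<epsilon> Q \<leftrightarrow>\<^sub>i (\<exists>\<^sub>i x. x \<epsilon> A \<and>\<^sub>i Slice x q))"
    using replacement[of w A "B ## e" ?\<psi>] unfolding \<psi> by blast
  then show ?thesis
  proof (rule exE_i)
    fix v Q assume v: "w \<le> v" and Q: "v \<tturnstile> (\<forall>\<^sub>i q. q \<epsilon> Q \<leftrightarrow>\<^sub>i (\<exists>\<^sub>i x. x \<epsilon> A \<and>\<^sub>i Slice x q))"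
    show "v \<tturnstile> (\<exists>\<^sub>i F. Hom F A B \<and>\<^sub>i
      (\<forall>\<^sub>i x y. Related F x y \<leftrightarrow>\<^sub>i (x \<epsilon> A \<and>\<^sub>i y \<epsilon> B \<and>\<^sub>i ev (y ## x ## e) \<phi>)))"
    proof (rule ex_mono_i[OF union[of v Q]])
      fix u F assume u: "v \<le> u" and F: "u \<tturnstile> (\<forall>\<^sub>i p. p \<epsilon> F \<leftrightarrow>\<^sub>i (\<exists>\<^sub>i q. q \<epsilon> Q \<and>\<^sub>i p \<epsilon> q))"
      have mem: "t \<tturnstile> p \<epsilon> F \<longleftrightarrow> t \<tturnstile> (\<exists>\<^sub>i x. x \<epsilon> A \<and>\<^sub>i Inner p x)" if t: "u \<le> t" for t p
      proof
        assume "t \<tturnstile> p \<epsilon> F"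
        then have "t \<tturnstile> (\<exists>\<^sub>i q. q \<epsilon> Q \<and>\<^sub>i p \<epsilon> q)" using all_iff_at[OF F t] by simp
        then show "t \<tturnstile> (\<exists>\<^sub>i x. x \<epsilon> A \<and>\<^sub>i Inner p x)"
        proof (rule bexE_i)
          fix s q assume s: "t \<le> s" "s \<tturnstile> q \<epsilon> Q" "s \<tturnstile> p \<epsilon> q"
          then have "s \<tturnstile> (\<exists>\<^sub>i x. x \<epsilon> A \<and>\<^sub>i Slice x q)"
            using all_iff_at[OF Q, of s q] u t by (meson order.trans)
          then show "s \<tturnstile> (\<exists>\<^sub>i x. x \<epsilon> A \<and>\<^sub>i Inner p x)"
            by (rule ex_mono_i) (use s in \<open>auto simp: Slice_def forces_iff intro: forces_mono\<close>)
        qed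
      next
        assume "t \<tturnstile> (\<exists>\<^sub>i x. x \<epsilon> A \<and>\<^sub>i Inner p x)"
        then have "t \<tturnstile> (\<exists>\<^sub>i q. q \<epsilon> Q \<and>\<^sub>i p \<epsilon> q)"
        proof (rule bexE_i)
          fix s x assume s: "t \<le> s" "s \<tturnstile> x \<epsilon> A" "s \<tturnstile> Inner p x"
          show "s \<tturnstile> (\<exists>\<^sub>i q. q \<epsilon> Q \<and>\<^sub>i p \<epsilon> q)"
          proof (rule ex_mono_i[OF slice[of s x]])
            fix r q assume r: "s \<le> r" "r \<tturnstile> Slice x q"
            have "r \<tturnstile> (\<exists>\<^sub>i x. x \<epsilon> A \<and>\<^sub>i Slice x q)"
              by (rule exI_i[of _ _ x]) (use s r in \<open>auto intro: forces_mono\<close>)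
            then have "r \<tturnstile> q \<epsilon> Q"
              using all_iff_at[OF Q, of r q] u t s r by (meson order.trans)
            moreover have "r \<tturnstile> p \<epsilon> q"
              using r(2) forces_mono[OF s(3) r(1)] by (simp add: Slice_def forces_iff)
            ultimately show "r \<tturnstile> (q \<epsilon> Q \<and>\<^sub>i p \<epsilon> q)" by simp
          qed
        qed
        then show "t \<tturnstile> p \<epsilon> F" using all_iff_at[OF F t] by simp
      qed
      have hom: "u \<tturnstile> Hom F A B"
      proof -
        have "t \<tturnstile> (\<exists>\<^sub>i x. x \<epsilon> A \<and>\<^sub>i (\<exists>\<^sub>i y. y \<epsilon> B \<and>\<^sub>i Opair p x y))"
          if "u \<le> t" "t \<tturnstile> p \<epsilon> F" for t p
          using that(2) unfolding mem[OF that(1)] Inner_def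
          by (rule ex_mono_i) (auto intro: ex_mono_i)
        then show ?thesis by (simp add: Hom_def forces_imp)
      qed
      have rel: "t \<tturnstile> Related F x y \<longleftrightarrow> t \<tturnstile> (x \<epsilon> A \<and>\<^sub>i y \<epsilon> B \<and>\<^sub>i ev (y ## x ## e) \<phi>)"
        if t: "u \<le> t" for t x y
      proof
        assume r: "t \<tturnstile> Related F x y"
        have "t \<tturnstile> ev (y ## x ## e) \<phi>"
        proof (rule bexE_i[OF r[unfolded Related_def]])
          fix s p assume s: "t \<le> s" "s \<tturnstile> p \<epsilon> F" "s \<tturnstile> Opair p x y"
          have "s \<tturnstile> (\<exists>\<^sub>i x. x \<epsilon> A \<and>\<^sub>i Inner p x)" using mem s t by (meson order.trans)
          then show "s \<tturnstile> ev (y ## x ## e) \<phi>"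
          proof (rule bexE_i)
            fix r x' assume r: "s \<le> r" "r \<tturnstile> Inner p x'"
            show "r \<tturnstile> ev (y ## x ## e) \<phi>"
            proof (rule bexE_i[OF r(2)[unfolded Inner_def]])
              fix r' y' assume r': "r \<le> r'" "r' \<tturnstile> (ev (y' ## x' ## e) \<phi> \<and>\<^sub>i Opair p x' y')"
              have "r' \<tturnstile> Opair p x' y'" using r' by simp
              then have eqs: "r' \<tturnstile> (x' \<approx> x \<and>\<^sub>i y' \<approx> y)"
                using forces_mono[OF s(3) order.trans[OF r(1) r'(1)]] by (rule Opair_inj)
              \<comment> \<open>the substitution rule acts on index \<open>0\<close>, so the arguments of \<open>\<phi>\<close> are exchanged to replace \<open>x'\<close>\<close>
              let ?swap = "Suc 0 ## 0 ## (\<lambda>i. Suc (Suc i))"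
              have swap: "(\<lambda>i. (a ## b ## e) (?swap i)) = b ## a ## e" for a b
                by (auto simp: fun_eq_iff split: nat.split)
              have "r' \<tturnstile> ev (x' ## y ## e) (ren ?swap \<phi>)"
                using approx_subst[of r' y' y "x' ## e" \<phi>] eqs r' by (simp add: ev_ren swap)
              then have "r' \<tturnstile> ev (x ## y ## e) (ren ?swap \<phi>)"
                using approx_subst eqs by auto
              then show "r' \<tturnstile> ev (y ## x ## e) \<phi>" by (simp add: ev_ren swap)
            qed
          qed
        qed
        then show "t \<tturnstile> (x \<epsilon> A \<and>\<^sub>i y \<epsilon> B \<and>\<^sub>i ev (y ## x ## e) \<phi>)"
          using Hom_Related[OF forces_mono[OF hom t] r] by simp
      next
        assume a: "t \<tturnstile> (x \<epsilon> A \<and>\<^sub>i y \<epsilon> B \<and>\<^sub>i ev (y ## x ## e) \<phi>)"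
        show "t \<tturnstile> Related F x y"
        proof (rule exE_i[OF ex_Opair[of t x y]])
          fix s p assume s: "t \<le> s" "s \<tturnstile> Opair p x y"
          note a = forces_mono[OF a s(1)]
          have "s \<tturnstile> Inner p x" unfolding Inner_def by (rule exI_i[of _ _ y]) (use a s in simp)
          then have "s \<tturnstile> (\<exists>\<^sub>i x. x \<epsilon> A \<and>\<^sub>i Inner p x)"
            by - (rule exI_i[of _ _ x], use a in simp)
          then have "s \<tturnstile> p \<epsilon> F" using mem s t by (meson order.trans)
          then show "s \<tturnstile> Related F x y" using s(2) by (rule RelatedI)
        qed
      qed
      show "u \<tturnstile> (Hom F A B \<and>\<^sub>i
        (\<forall>\<^sub>i x y. Related F x y \<leftrightarrow>\<^sub>i (x \<epsilon> A \<and>\<^sub>i y \<epsilon> B \<and>\<^sub>i ev (y ## x ## e) \<phi>)))"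
        using hom rel by (simp add: forces_iff)
    qed
  qed
qed

text \<open>Equality of composites, which is stated through pairs in a common set \<open>k\<close>, is thereby reduced to a statement
about related elements.\<close>

lemma Comp_Related:
  assumes "w \<tturnstile> Comp k g f"
  shows "w \<tturnstile> Related k x z \<longleftrightarrow> w \<tturnstile> (\<exists>\<^sub>i y. Related f x y \<and>\<^sub>i Related g y z)"
proof
  assume "w \<tturnstile> Related k x z"
  then show "w \<tturnstile> (\<exists>\<^sub>i y. Related f x y \<and>\<^sub>i Related g y z)"
    unfolding Related_def[of k]
  proof (rule bexE_i)
    fix v p assume v: "w \<le> v" "v \<tturnstile> p \<epsilon> k" "v \<tturnstile> Opair p x z"
    have "v \<tturnstile> (\<exists>\<^sub>i x y z. Opair p x z \<and>\<^sub>i Related f x y \<and>\<^sub>i Related g y z)"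
      using all_iff_at[OF assms[unfolded Comp_def] v(1)] v(2) by blast
    then show "v \<tturnstile> (\<exists>\<^sub>i y. Related f x y \<and>\<^sub>i Related g y z)"
    proof (rule exE3_i)
      fix u x' y z'
      assume u: "v \<le> u" and a: "u \<tturnstile> (Opair p x' z' \<and>\<^sub>i Related f x' y \<and>\<^sub>i Related g y z')"
      have "u \<tturnstile> (x' \<approx> x \<and>\<^sub>i z' \<approx> z)"
        using a forces_mono[OF v(3) u] by (auto intro!: Opair_inj simp del: forces_and) simp
      then have "u \<tturnstile> (Related f x y \<and>\<^sub>i Related g y z)"
        using a by (auto intro: Related_cong approx_refl)
      then show "u \<tturnstile> (\<exists>\<^sub>i y. Related f x y \<and>\<^sub>i Related g y z)" by (rule exI_i)
    qed
  qed
next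
  assume "w \<tturnstile> (\<exists>\<^sub>i y. Related f x y \<and>\<^sub>i Related g y z)"
  then show "w \<tturnstile> Related k x z"
  proof (rule bexE_i)
    fix v y assume v: "w \<le> v" "v \<tturnstile> Related f x y" "v \<tturnstile> Related g y z"
    show "v \<tturnstile> Related k x z"
    proof (rule exE_i[OF ex_Opair[of v x z]])
      fix u p assume u: "v \<le> u" "u \<tturnstile> Opair p x z"
      have "u \<tturnstile> (\<exists>\<^sub>i x y z. Opair p x z \<and>\<^sub>i Related f x y \<and>\<^sub>i Related g y z)"
        by (rule exI3_i[of _ _ x y z]) (use v u forces_mono in auto)
      then have "u \<tturnstile> p \<epsilon> k"
        using all_iff_at[OF assms[unfolded Comp_def] order.trans[OF v(1) u(1)]] by blast
      then show "u \<tturnstile> Related k x z" using u(2) by (rule RelatedI)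
    qed
  qed
qed

lemma CompI:
  assumes hom: "w \<tturnstile> Hom k C B"
    and rel: "\<And>v x z. w \<le> v \<Longrightarrow>
      v \<tturnstile> Related k x z \<longleftrightarrow> v \<tturnstile> (\<exists>\<^sub>i y. Related f x y \<and>\<^sub>i Related g y z)"
  shows "w \<tturnstile> Comp k g f"
proof -
  have "v \<tturnstile> p \<epsilon> k \<longleftrightarrow> v \<tturnstile> (\<exists>\<^sub>i x y z. Opair p x z \<and>\<^sub>i Related f x y \<and>\<^sub>i Related g y z)"
    if v: "w \<le> v" for v p
  proof
    assume p: "v \<tturnstile> p \<epsilon> k"
    then have "v \<tturnstile> (\<exists>\<^sub>i x. x \<epsilon> C \<and>\<^sub>i (\<exists>\<^sub>i z. z \<epsilon> B \<and>\<^sub>i Opair p x z))"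
      using hom v by (simp add: Hom_def forces_imp)
    then show "v \<tturnstile> (\<exists>\<^sub>i x y z. Opair p x z \<and>\<^sub>i Related f x y \<and>\<^sub>i Related g y z)"
    proof (rule bexE_i, elim bexE_i)
      fix u t x z assume u: "v \<le> u" "u \<le> t" and o: "t \<tturnstile> Opair p x z"
      have "t \<tturnstile> Related k x z"
        by (rule RelatedI[OF forces_mono[OF p order.trans[OF u]] o])
      then have "t \<tturnstile> (\<exists>\<^sub>i y. Related f x y \<and>\<^sub>i Related g y z)"
        using rel u v by (meson order.trans)
      then show "t \<tturnstile> (\<exists>\<^sub>i x y z. Opair p x z \<and>\<^sub>i Related f x y \<and>\<^sub>i Related g y z)"
      proof (rule exE_i)
        fix s y assume s: "t \<le> s" "s \<tturnstile> (Related f x y \<and>\<^sub>i Related g y z)"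
        show "s \<tturnstile> (\<exists>\<^sub>i x y z. Opair p x z \<and>\<^sub>i Related f x y \<and>\<^sub>i Related g y z)"
          by (rule exI3_i[of _ _ x y z]) (use s forces_mono[OF o s(1)] in simp)
      qed
    qed
  next
    assume "v \<tturnstile> (\<exists>\<^sub>i x y z. Opair p x z \<and>\<^sub>i Related f x y \<and>\<^sub>i Related g y z)"
    then show "v \<tturnstile> p \<epsilon> k"
    proof (rule exE3_i)
      fix u x y z
      assume u: "v \<le> u" and a: "u \<tturnstile> (Opair p x z \<and>\<^sub>i Related f x y \<and>\<^sub>i Related g y z)"
      have "u \<tturnstile> (\<exists>\<^sub>i y. Related f x y \<and>\<^sub>i Related g y z)"
        by (rule exI_i[of _ _ y]) (use a in simp)
      then have "u \<tturnstile> Related k x z" using rel u v by (meson order.trans)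
      then show "u \<tturnstile> p \<epsilon> k"
        unfolding Related_def
      proof (rule bexE_i)
        fix t q assume t: "u \<le> t" "t \<tturnstile> q \<epsilon> k" "t \<tturnstile> Opair q x z"
        have "t \<tturnstile> Opair p x z" using forces_mono[OF a t(1)] by simp
        then show "t \<tturnstile> p \<epsilon> k" using t by (blast intro: mem_cong_left Opair_unique)
      qed
    qed
  qed
  then show ?thesis by (simp add: Comp_def forces_iff)
qed

definition Equalises :: "nat \<Rightarrow> nat \<Rightarrow> nat \<Rightarrow> tv" where
  "Equalises f g h = (\<forall>\<^sub>i x z. (\<exists>\<^sub>i y. Related h x y \<and>\<^sub>i Related f y z) \<leftrightarrow>\<^sub>i
    (\<exists>\<^sub>i y. Related h x y \<and>\<^sub>i Related g y z))"

text \<open>The common composite has to exist as a set; it is obtained by comprehension over \<open>C\<close> and \<open>B\<close>, with the middle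
element bounded by \<open>A\<close> so that the formula is restricted.\<close>

lemma Equalises_iff:
  assumes hom: "w \<tturnstile> Hom h C A" "w \<tturnstile> Hom f A B"
  shows "w \<tturnstile> (\<exists>\<^sub>i k. Comp k f h \<and>\<^sub>i Comp k g h) \<longleftrightarrow> w \<tturnstile> Equalises f g h"
proof
  assume "w \<tturnstile> (\<exists>\<^sub>i k. Comp k f h \<and>\<^sub>i Comp k g h)"
  then show "w \<tturnstile> Equalises f g h"
  proof (rule bexE_i)
    fix v k assume k: "v \<tturnstile> Comp k f h" "v \<tturnstile> Comp k g h"
    show "v \<tturnstile> Equalises f g h"
      using k[THEN forces_mono, THEN Comp_Related] by (auto simp: Equalises_def forces_iff)
  qed
next
  assume eq: "w \<tturnstile> Equalises f g h"
  \<comment> \<open>\<open>\<exists>y\<in>A. h x y \<and> f y z\<close> in the environment \<open>z, x, h, f, A\<close>\<close>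
  let ?\<phi> = "Exists (And (Mem 0 5) (And (related 2 3 5 6) (related 1 5 4 6)))"
  have "restricted ?\<phi>" by (intro restrictedI restricted_related) simp_all
  from relation_comprehension[OF this, of w C B "h ## f ## A ## id"]
  show "w \<tturnstile> (\<exists>\<^sub>i k. Comp k f h \<and>\<^sub>i Comp k g h)"
  proof (rule exE_i, unfold forces_and, elim conjE)
    fix v k
    assume v: "w \<le> v" and k: "v \<tturnstile> Hom k C B" and "v \<tturnstile> (\<forall>\<^sub>i x z. Related k x z \<leftrightarrow>\<^sub>i
      (x \<epsilon> C \<and>\<^sub>i z \<epsilon> B \<and>\<^sub>i ev (z ## x ## h ## f ## A ## id) ?\<phi>))"
    then have r: "u \<tturnstile> Related k x z \<longleftrightarrow> u \<tturnstile> x \<epsilon> C \<and> u \<tturnstile> z \<epsilon> B \<and>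
        u \<tturnstile> (\<exists>\<^sub>i y. y \<epsilon> A \<and>\<^sub>i Related h x y \<and>\<^sub>i Related f y z)" if "v \<le> u" for u x z
      using that by (simp add: forces_iff ev_related eval_nat_numeral)
    have rf: "u \<tturnstile> Related k x z \<longleftrightarrow> u \<tturnstile> (\<exists>\<^sub>i y. Related h x y \<and>\<^sub>i Related f y z)"
      if u: "v \<le> u" for u x z
    proof
      assume "u \<tturnstile> Related k x z"
      then have "u \<tturnstile> (\<exists>\<^sub>i y. y \<epsilon> A \<and>\<^sub>i Related h x y \<and>\<^sub>i Related f y z)" using r[OF u] by simp
      then show "u \<tturnstile> (\<exists>\<^sub>i y. Related h x y \<and>\<^sub>i Related f y z)" by (rule ex_mono_i) simp
    next
      assume e: "u \<tturnstile> (\<exists>\<^sub>i y. Related h x y \<and>\<^sub>i Related f y z)"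
      note hom = hom[THEN forces_mono, OF order.trans[OF v u]]
      have "u \<tturnstile> (x \<epsilon> C \<and>\<^sub>i z \<epsilon> B)"
        by (rule bexE_i[OF e]) (use Hom_Related hom forces_mono in \<open>metis forces_and\<close>)
      moreover have "u \<tturnstile> (\<exists>\<^sub>i y. y \<epsilon> A \<and>\<^sub>i Related h x y \<and>\<^sub>i Related f y z)"
        using e by (rule ex_mono_i) (use Hom_Related hom forces_mono in \<open>metis forces_and\<close>)
      ultimately show "u \<tturnstile> Related k x z" using r[OF u] by simp
    qed
    have rg: "u \<tturnstile> Related k x z \<longleftrightarrow> u \<tturnstile> (\<exists>\<^sub>i y. Related h x y \<and>\<^sub>i Related g y z)"
      if u: "v \<le> u" for u x z
      using rf[OF u] eq order.trans[OF v u] by (simp add: Equalises_def forces_iff)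
    show "v \<tturnstile> (\<exists>\<^sub>i k. Comp k f h \<and>\<^sub>i Comp k g h)"
      by (rule exI_i[of _ _ k]) (use CompI[OF k rf] CompI[OF k rg] in simp)
  qed
qed

definition Fibre :: "nat \<Rightarrow> nat \<Rightarrow> nat \<Rightarrow> tv" where
  "Fibre f y a = (\<forall>\<^sub>i x. x \<epsilon> a \<leftrightarrow>\<^sub>i Related f x y)"

definition Image :: "nat \<Rightarrow> nat \<Rightarrow> nat \<Rightarrow> tv" where
  "Image f x b = (\<forall>\<^sub>i y. y \<epsilon> b \<leftrightarrow>\<^sub>i Related f x y)"

lemma FibreD: "w \<tturnstile> Fibre f y a \<Longrightarrow> w \<le> v \<Longrightarrow> v \<tturnstile> x \<epsilon> a \<longleftrightarrow> v \<tturnstile> Related f x y"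
  by (simp add: Fibre_def forces_iff)

lemma ImageD: "w \<tturnstile> Image f x b \<Longrightarrow> w \<le> v \<Longrightarrow> v \<tturnstile> y \<epsilon> b \<longleftrightarrow> v \<tturnstile> Related f x y"
  by (simp add: Image_def forces_iff)

lemma ex_Fibre: assumes "w \<tturnstile> Hom f A B" shows "w \<tturnstile> (\<exists>\<^sub>i a. Fibre f y a)"
proof -
  have "w \<tturnstile> (\<exists>\<^sub>i a. \<forall>\<^sub>i x. x \<epsilon> a \<leftrightarrow>\<^sub>i (x \<epsilon> A \<and>\<^sub>i Related f x y))"
    using separation[of "related 0 3 1 4" w A "y ## f ## id"]
    by (simp add: restricted_related ev_related eval_nat_numeral)
  then show ?thesis
    by (rule ex_mono_i)
      (use Hom_Related(1)[OF forces_mono[OF assms]] in \<open>auto simp: Fibre_def forces_iff intro: order.trans\<close>)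
qed

lemma ex_Image: assumes "w \<tturnstile> Hom f A B" shows "w \<tturnstile> (\<exists>\<^sub>i b. Image f x b)"
proof -
  have "w \<tturnstile> (\<exists>\<^sub>i b. \<forall>\<^sub>i y. y \<epsilon> b \<leftrightarrow>\<^sub>i (y \<epsilon> B \<and>\<^sub>i Related f x y))"
    using separation[of "related 0 1 3 4" w B "x ## f ## id"]
    by (simp add: restricted_related ev_related eval_nat_numeral)
  then show ?thesis
    by (rule ex_mono_i)
      (use Hom_Related(2)[OF forces_mono[OF assms]] in \<open>auto simp: Image_def forces_iff intro: order.trans\<close>)
qed

section \<open>Weak equalisers and set-generation\<close>

definition Balanced :: "nat \<Rightarrow> nat \<Rightarrow> nat \<Rightarrow> tv" where
  "Balanced f g a = (\<forall>\<^sub>i y. (\<exists>\<^sub>i x. x \<epsilon> a \<and>\<^sub>i Related f x y) \<leftrightarrow>\<^sub>i (\<exists>\<^sub>i x. x \<epsilon> a \<and>\<^sub>i Related g x y))"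

definition Set_generated :: "(nat \<Rightarrow> tv) \<Rightarrow> tv" where
  "Set_generated C = (\<exists>\<^sub>i G. (\<forall>\<^sub>i b. b \<epsilon> G \<rightarrow>\<^sub>i C b) \<and>\<^sub>i
    (\<forall>\<^sub>i a. C a \<rightarrow>\<^sub>i (\<forall>\<^sub>i x. x \<epsilon> a \<rightarrow>\<^sub>i (\<exists>\<^sub>i b. b \<epsilon> G \<and>\<^sub>i x \<epsilon> b \<and>\<^sub>i Sub b a))))"

definition Weak_equaliser :: "nat \<Rightarrow> nat \<Rightarrow> nat \<Rightarrow> tv" where
  "Weak_equaliser A f g = (\<exists>\<^sub>i E e. Hom e E A \<and>\<^sub>i (\<exists>\<^sub>i k. Comp k f e \<and>\<^sub>i Comp k g e) \<and>\<^sub>i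
    (\<forall>\<^sub>i C h. Hom h C A \<and>\<^sub>i (\<exists>\<^sub>i k. Comp k f h \<and>\<^sub>i Comp k g h) \<rightarrow>\<^sub>i
      (\<exists>\<^sub>i h'. Hom h' C E \<and>\<^sub>i Comp h e h')))"

lemma SubD: "w \<tturnstile> Sub a b \<Longrightarrow> w \<le> v \<Longrightarrow> v \<tturnstile> x \<epsilon> a \<Longrightarrow> v \<tturnstile> x \<epsilon> b"
  by (simp add: Sub_def forces_imp)

lemma SubI: "(\<And>v x. w \<le> v \<Longrightarrow> v \<tturnstile> x \<epsilon> a \<Longrightarrow> v \<tturnstile> x \<epsilon> b) \<Longrightarrow> w \<tturnstile> Sub a b"
  by (simp add: Sub_def forces_imp)

lemma BalancedD:
  "w \<tturnstile> Balanced f g a \<Longrightarrow> w \<le> v \<Longrightarrow>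
    v \<tturnstile> (\<exists>\<^sub>i x. x \<epsilon> a \<and>\<^sub>i Related f x y) \<longleftrightarrow> v \<tturnstile> (\<exists>\<^sub>i x. x \<epsilon> a \<and>\<^sub>i Related g x y)"
  by (simp add: Balanced_def forces_iff)

lemma Balanced_sym: "w \<tturnstile> Balanced f g a \<longleftrightarrow> w \<tturnstile> Balanced g f a"
  by (auto simp: Balanced_def forces_iff)

text \<open>For \<open>\<alpha> = h[c]\<close>, balancedness is the equation \<open>f \<circ> h = g \<circ> h\<close> at the point \<open>c\<close>.\<close>

lemma Balanced_Image:
  assumes "w \<tturnstile> Equalises f g h" "w \<tturnstile> Image h c a" shows "w \<tturnstile> Balanced f g a"
proof -
  have "v \<tturnstile> (\<exists>\<^sub>i x. x \<epsilon> a \<and>\<^sub>i Related r x y) \<longleftrightarrow> v \<tturnstile> (\<exists>\<^sub>i x. Related h c x \<and>\<^sub>i Related r x y)"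
    if v: "w \<le> v" for v r y
  proof (rule ex_cong_i)
    fix u x assume "v \<le> u"
    then show "u \<tturnstile> (x \<epsilon> a \<and>\<^sub>i Related r x y) \<longleftrightarrow> u \<tturnstile> (Related h c x \<and>\<^sub>i Related r x y)"
      using ImageD[OF assms(2) order.trans[OF v]] by simp
  qed
  then show ?thesis using assms(1) by (simp add: Balanced_def Equalises_def forces_iff)
qed

text \<open>A relation whose image at each \<open>c\<close> in its domain is balanced equalises \<open>f\<close> and \<open>g\<close>. It is used for the
relation \<open>\<ni>\<close> from a generating set to \<open>A\<close>, and for \<open>\<ni>\<close> from a singleton \<open>{\<alpha>}\<close> to \<open>A\<close>.\<close>

lemma EqualisesI:
  assumes hom: "w \<tturnstile> Hom f A B" "w \<tturnstile> Hom g A B"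
    and mem: "\<And>v c x. w \<le> v \<Longrightarrow> v \<tturnstile> Related h c x \<longleftrightarrow> v \<tturnstile> (D c \<and>\<^sub>i x \<epsilon> A \<and>\<^sub>i x \<epsilon> c)"
    and bal: "\<And>v c. w \<le> v \<Longrightarrow> v \<tturnstile> D c \<Longrightarrow> v \<tturnstile> Balanced f g c"
  shows "w \<tturnstile> Equalises f g h"
proof -
  have half: "v \<tturnstile> (\<exists>\<^sub>i x. Related h c x \<and>\<^sub>i Related q x z)"
    if v: "w \<le> v" and e: "v \<tturnstile> (\<exists>\<^sub>i x. Related h c x \<and>\<^sub>i Related p x z)"
      and q: "w \<tturnstile> Hom q A B"
      and pq: "\<And>v c. w \<le> v \<Longrightarrow> v \<tturnstile> D c \<Longrightarrow> v \<tturnstile> Balanced p q c" for v c z p q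
  proof (rule bexE_i[OF e])
    fix u x assume u: "v \<le> u" "u \<tturnstile> Related h c x" "u \<tturnstile> Related p x z"
    note wu = order.trans[OF v u(1)]
    have d: "u \<tturnstile> D c" "u \<tturnstile> x \<epsilon> c" using mem[OF wu] u(2) by simp_all
    have "u \<tturnstile> (\<exists>\<^sub>i x. x \<epsilon> c \<and>\<^sub>i Related p x z)"
      by (rule exI_i[of _ _ x]) (use u d in simp)
    then have "u \<tturnstile> (\<exists>\<^sub>i x. x \<epsilon> c \<and>\<^sub>i Related q x z)"
      using BalancedD[OF pq[OF wu d(1)] order.refl] by blast
    then show "u \<tturnstile> (\<exists>\<^sub>i x. Related h c x \<and>\<^sub>i Related q x z)"
    proof (rule ex_mono_i)
      fix t x assume t: "u \<le> t" "t \<tturnstile> (x \<epsilon> c \<and>\<^sub>i Related q x z)"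
      have "t \<tturnstile> x \<epsilon> A"
        using Hom_Related(1)[OF forces_mono[OF q order.trans[OF wu t(1)]]] t(2) by auto
      then show "t \<tturnstile> (Related h c x \<and>\<^sub>i Related q x z)"
        using mem[OF order.trans[OF wu t(1)]] t(2) forces_mono[OF d(1) t(1)] by simp
    qed
  qed
  have lr: "v \<tturnstile> (\<exists>\<^sub>i x. Related h c x \<and>\<^sub>i Related g x z)"
    if "w \<le> v" "v \<tturnstile> (\<exists>\<^sub>i x. Related h c x \<and>\<^sub>i Related f x z)" for v c z
    using that hom(2) bal by (rule half)
  have rl: "v \<tturnstile> (\<exists>\<^sub>i x. Related h c x \<and>\<^sub>i Related f x z)"
    if "w \<le> v" "v \<tturnstile> (\<exists>\<^sub>i x. Related h c x \<and>\<^sub>i Related g x z)" for v c z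
    using that hom(1) bal[THEN Balanced_sym[THEN iffD1]] by (rule half)
  show ?thesis using lr rl by (auto simp: Equalises_def forces_iff)
qed

lemma Weak_equaliserI:
  assumes "w \<tturnstile> Hom e E A" "w \<tturnstile> Hom f A B" "w \<tturnstile> Equalises f g e"
    and univ: "\<And>v C h. w \<le> v \<Longrightarrow> v \<tturnstile> Hom h C A \<Longrightarrow> v \<tturnstile> Equalises f g h \<Longrightarrow>
      v \<tturnstile> (\<exists>\<^sub>i h'. Hom h' C E \<and>\<^sub>i Comp h e h')"
  shows "w \<tturnstile> Weak_equaliser A f g"
proof -
  have u: "v \<tturnstile> (\<exists>\<^sub>i h'. Hom h' C E \<and>\<^sub>i Comp h e h')"
    if "w \<le> v" "v \<tturnstile> Hom h C A" "v \<tturnstile> (\<exists>\<^sub>i k. Comp k f h \<and>\<^sub>i Comp k g h)" for v C h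
    using univ[OF that(1,2)] that(3) Equalises_iff[OF that(2) forces_mono[OF assms(2) that(1)]]
    by simp
  show ?thesis
    unfolding Weak_equaliser_def
    by (rule exI_i[of _ _ E], rule exI_i[of _ _ e])
      (use assms(1,3) u Equalises_iff[OF assms(1,2)] in \<open>simp add: forces_imp\<close>)
qed

text \<open>The weak equaliser is \<open>\<ni>\<close> from \<open>G\<close> to \<open>A\<close>, and the factorisation of \<open>h\<close> relates \<open>c\<close> to the \<open>\<beta> \<in> G\<close> with
\<open>\<beta> \<subseteq> h[c]\<close>. The inclusion is a restricted formula in \<open>\<beta>\<close>, \<open>c\<close> and \<open>h\<close>, so no choice of such \<open>\<beta>\<close> is
involved.\<close>

lemma Weak_equaliser_of_Set_generated:
  assumes hom: "w \<tturnstile> Hom f A B" "w \<tturnstile> Hom g A B"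
    and gen: "w \<tturnstile> Set_generated (\<lambda>a. Sub a A \<and>\<^sub>i Balanced f g a)"
  shows "w \<tturnstile> Weak_equaliser A f g"
proof (rule bexE_i[OF gen[unfolded Set_generated_def]])
  fix v G
  assume v: "w \<le> v" and "v \<tturnstile> (\<forall>\<^sub>i b. b \<epsilon> G \<rightarrow>\<^sub>i Sub b A \<and>\<^sub>i Balanced f g b)"
    and "v \<tturnstile> (\<forall>\<^sub>i a. Sub a A \<and>\<^sub>i Balanced f g a \<rightarrow>\<^sub>i
      (\<forall>\<^sub>i x. x \<epsilon> a \<rightarrow>\<^sub>i (\<exists>\<^sub>i b. b \<epsilon> G \<and>\<^sub>i x \<epsilon> b \<and>\<^sub>i Sub b a)))"
  then have G: "\<And>u b. v \<le> u \<Longrightarrow> u \<tturnstile> b \<epsilon> G \<Longrightarrow> u \<tturnstile> Sub b A \<and> u \<tturnstile> Balanced f g b"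
    and cover: "\<And>u a x. v \<le> u \<Longrightarrow> u \<tturnstile> Sub a A \<Longrightarrow> u \<tturnstile> Balanced f g a \<Longrightarrow> u \<tturnstile> x \<epsilon> a \<Longrightarrow>
      u \<tturnstile> (\<exists>\<^sub>i b. b \<epsilon> G \<and>\<^sub>i x \<epsilon> b \<and>\<^sub>i Sub b a)"
    by (simp_all add: forces_imp)
  have "restricted (Mem 0 1)" by (intro restrictedI)
  from relation_comprehension[OF this, of v G A id]
  show "v \<tturnstile> Weak_equaliser A f g"
  proof (rule bexE_i)
    fix u e
    assume u: "v \<le> u" and e: "u \<tturnstile> Hom e G A"
      and "u \<tturnstile> (\<forall>\<^sub>i b x. Related e b x \<leftrightarrow>\<^sub>i (b \<epsilon> G \<and>\<^sub>i x \<epsilon> A \<and>\<^sub>i ev (x ## b ## id) (Mem 0 1)))"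
    then have rel: "\<And>t b x. u \<le> t \<Longrightarrow>
        t \<tturnstile> Related e b x \<longleftrightarrow> t \<tturnstile> (b \<epsilon> G \<and>\<^sub>i x \<epsilon> A \<and>\<^sub>i x \<epsilon> b)"
      by (simp add: forces_iff)
    note hom = hom[THEN forces_mono, OF order.trans[OF v u]]
    note G = G[OF order.trans[OF u]] and cover = cover[OF order.trans[OF u]]
    show "u \<tturnstile> Weak_equaliser A f g"
    proof (rule Weak_equaliserI[OF e hom(1)])
      show "u \<tturnstile> Equalises f g e"
        by (rule EqualisesI[OF hom rel]) (use G in auto)
    next
      fix t C h assume t: "u \<le> t" and h: "t \<tturnstile> Hom h C A" and eq: "t \<tturnstile> Equalises f g h"
      \<comment> \<open>\<open>\<forall>x\<in>b. h c x\<close> in the environment \<open>b, c, h\<close>\<close>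
      let ?\<phi> = "Forall (Imp (Mem 0 1) (related 0 1 3 4))"
      have "restricted ?\<phi>" by (intro restrictedI restricted_related) simp_all
      from relation_comprehension[OF this, of t C G "h ## id"]
      show "t \<tturnstile> (\<exists>\<^sub>i h'. Hom h' C G \<and>\<^sub>i Comp h e h')"
      proof (rule ex_mono_i, unfold forces_and, elim conjE)
        fix s h'
        assume s: "t \<le> s" and h': "s \<tturnstile> Hom h' C G" and "s \<tturnstile> (\<forall>\<^sub>i c b. Related h' c b \<leftrightarrow>\<^sub>i
          (c \<epsilon> C \<and>\<^sub>i b \<epsilon> G \<and>\<^sub>i ev (b ## c ## h ## id) ?\<phi>))"
        then have rel': "\<And>r c b. s \<le> r \<Longrightarrow> r \<tturnstile> Related h' c b \<longleftrightarrow>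
            r \<tturnstile> c \<epsilon> C \<and> r \<tturnstile> b \<epsilon> G \<and> r \<tturnstile> (\<forall>\<^sub>i x. x \<epsilon> b \<rightarrow>\<^sub>i Related h c x)"
          by (simp add: forces_iff ev_related eval_nat_numeral)
        have "s \<tturnstile> Comp h e h'"
        proof (rule CompI[OF forces_mono[OF h s]], rule iffI)
          fix r c x assume r: "s \<le> r"
          note ur = order.trans[OF order.trans[OF t s] r]
          note h = forces_mono[OF h order.trans[OF s r]]
            and eq = forces_mono[OF eq order.trans[OF s r]]
          {
            assume c: "r \<tturnstile> Related h c x"
            show "r \<tturnstile> (\<exists>\<^sub>i b. Related h' c b \<and>\<^sub>i Related e b x)"
            proof (rule exE_i[OF ex_Image[OF h, of c]])
              fix q a assume q: "r \<le> q" and a: "q \<tturnstile> Image h c a"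
              have "q \<tturnstile> (\<exists>\<^sub>i b. b \<epsilon> G \<and>\<^sub>i x \<epsilon> b \<and>\<^sub>i Sub b a)"
              proof (rule cover[OF order.trans[OF ur q]])
                show "q \<tturnstile> Balanced f g a"
                  by (rule Balanced_Image[OF forces_mono[OF eq q] a])
                show "q \<tturnstile> Sub a A"
                  by (rule SubI) (use ImageD[OF a] Hom_Related(2)[OF forces_mono[OF h]] q
                    in \<open>blast intro: order.trans\<close>)
                show "q \<tturnstile> x \<epsilon> a" using ImageD[OF a order.refl] forces_mono[OF c q] by simp
              qed
              then show "q \<tturnstile> (\<exists>\<^sub>i b. Related h' c b \<and>\<^sub>i Related e b x)"
              proof (rule ex_mono_i)
                fix p b assume p: "q \<le> p" and b: "p \<tturnstile> (b \<epsilon> G \<and>\<^sub>i x \<epsilon> b \<and>\<^sub>i Sub b a)"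
                note rp = order.trans[OF q p]
                have x: "p \<tturnstile> c \<epsilon> C" "p \<tturnstile> x \<epsilon> A"
                  using Hom_Related[OF forces_mono[OF h rp] forces_mono[OF c rp]] .
                have "p \<tturnstile> (\<forall>\<^sub>i x. x \<epsilon> b \<rightarrow>\<^sub>i Related h c x)"
                  using b ImageD[OF a order.trans[OF p]] by (auto simp: forces_imp intro: SubD)
                then show "p \<tturnstile> (Related h' c b \<and>\<^sub>i Related e b x)"
                  using rel'[OF order.trans[OF r rp]] rel[OF order.trans[OF ur rp]] b x by simp
              qed
            qed
          next
            assume "r \<tturnstile> (\<exists>\<^sub>i b. Related h' c b \<and>\<^sub>i Related e b x)"
            then show "r \<tturnstile> Related h c x"
            proof (rule bexE_i)
              fix q b assume q: "r \<le> q" and "q \<tturnstile> Related h' c b" "q \<tturnstile> Related e b x"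
              then have "q \<tturnstile> (\<forall>\<^sub>i x. x \<epsilon> b \<rightarrow>\<^sub>i Related h c x)" "q \<tturnstile> x \<epsilon> b"
                using rel'[OF order.trans[OF r q]] rel[OF order.trans[OF ur q]] by simp_all
              then show "q \<tturnstile> Related h c x" by (simp add: forces_imp)
            qed
          }
        qed
        then show "s \<tturnstile> Hom h' C G \<and> s \<tturnstile> Comp h e h'" using h' by simp
      qed
    qed
  qed
qed

text \<open>The generating set consists of the images \<open>e[t]\<close>. To cover a balanced \<open>\<alpha>\<close>, the universal property is applied
to the relation \<open>\<ni>\<close> from the singleton \<open>{\<alpha>}\<close> to \<open>A\<close>; the factorisation shows \<open>\<alpha>\<close> to be the union of
the \<open>e[t]\<close> for the \<open>t\<close> related to \<open>\<alpha>\<close>.\<close>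

lemma Set_generated_of_Weak_equaliser:
  assumes hom: "w \<tturnstile> Hom f A B" "w \<tturnstile> Hom g A B" and weq: "w \<tturnstile> Weak_equaliser A f g"
  shows "w \<tturnstile> Set_generated (\<lambda>a. Sub a A \<and>\<^sub>i Balanced f g a)"
proof (rule exE_i[OF weq[unfolded Weak_equaliser_def]], rule exE_i, assumption,
    unfold forces_and, elim conjE)
  fix v0 E v e
  assume v0: "w \<le> v0" "v0 \<le> v" and e: "v \<tturnstile> Hom e E A"
    and k: "v \<tturnstile> (\<exists>\<^sub>i k. Comp k f e \<and>\<^sub>i Comp k g e)"
    and un: "v \<tturnstile> (\<forall>\<^sub>i C h. Hom h C A \<and>\<^sub>i (\<exists>\<^sub>i k. Comp k f h \<and>\<^sub>i Comp k g h) \<rightarrow>\<^sub>i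
      (\<exists>\<^sub>i h'. Hom h' C E \<and>\<^sub>i Comp h e h'))"
  have v: "w \<le> v" using v0 by (rule order.trans)
  note hom = hom[THEN forces_mono, OF v]
  have eq: "v \<tturnstile> Equalises f g e" using Equalises_iff[OF e hom(1)] k by simp
  have univ: "u \<tturnstile> (\<exists>\<^sub>i h'. Hom h' C E \<and>\<^sub>i Comp h e h')"
    if "v \<le> u" "u \<tturnstile> Hom h C A" "u \<tturnstile> Equalises f g h" for u h C
    using un that Equalises_iff[OF that(2) forces_mono[OF hom(1) that(1)]] by (simp add: forces_imp)
  \<comment> \<open>\<open>b\<close> is the image of \<open>t\<close> under \<open>e\<close>, in the environment \<open>t, b, E, e\<close>\<close>
  let ?\<psi> = "Forall (And (Imp (Mem 0 2) (related 0 3 4 5)) (Imp (related 0 3 4 5) (Mem 0 2)))"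
  have \<psi>: "ev (t ## b ## E ## e ## id) ?\<psi> = Image e t b" for t b
    by (simp add: Image_def tv_iff_def ev_related eval_nat_numeral)
  have "u \<tturnstile> (\<exists>\<^sub>i b. Image e t b \<and>\<^sub>i (\<forall>\<^sub>i c. Image e t c \<rightarrow>\<^sub>i c \<approx> b))" if u: "v \<le> u" for u t
  proof (rule ex_mono_i[OF ex_Image[OF forces_mono[OF e u]]])
    fix s b assume b: "s \<tturnstile> Image e t b"
    have "r \<tturnstile> c \<approx> b" if "s \<le> r" "r \<tturnstile> Image e t c" for r c
      by (rule ext_of_iff) (use ImageD[OF b] ImageD[OF that(2)] that(1) in \<open>metis order.trans\<close>)
    then show "s \<tturnstile> (Image e t b \<and>\<^sub>i (\<forall>\<^sub>i c. Image e t c \<rightarrow>\<^sub>i c \<approx> b))"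
      using b by (simp add: forces_imp)
  qed
  then have "v \<tturnstile> (\<exists>\<^sub>i G. \<forall>\<^sub>i b. b \<epsilon> G \<leftrightarrow>\<^sub>i (\<exists>\<^sub>i t. t \<epsilon> E \<and>\<^sub>i Image e t b))"
    using replacement[of v E "e ## id" ?\<psi>] unfolding \<psi> by blast
  then show "v \<tturnstile> Set_generated (\<lambda>a. Sub a A \<and>\<^sub>i Balanced f g a)"
    unfolding Set_generated_def
  proof (rule ex_mono_i)
    fix u G assume u: "v \<le> u" and "u \<tturnstile> (\<forall>\<^sub>i b. b \<epsilon> G \<leftrightarrow>\<^sub>i (\<exists>\<^sub>i t. t \<epsilon> E \<and>\<^sub>i Image e t b))"
    then have G: "\<And>s b. u \<le> s \<Longrightarrow> s \<tturnstile> b \<epsilon> G \<longleftrightarrow> s \<tturnstile> (\<exists>\<^sub>i t. t \<epsilon> E \<and>\<^sub>i Image e t b)"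
      by (simp add: forces_iff)
    have sub: "s \<tturnstile> (Sub b A \<and>\<^sub>i Balanced f g b)" if s: "u \<le> s" and b: "s \<tturnstile> b \<epsilon> G" for s b
    proof (rule bexE_i[OF iffD1[OF G[OF s] b]])
      fix r t assume r: "s \<le> r" and i: "r \<tturnstile> Image e t b"
      note vr = order.trans[OF u order.trans[OF s r]]
      have "r \<tturnstile> Balanced f g b" by (rule Balanced_Image[OF forces_mono[OF eq vr] i])
      moreover have "r \<tturnstile> Sub b A"
        by (rule SubI) (use ImageD[OF i] Hom_Related(2)[OF forces_mono[OF e]] vr
          in \<open>blast intro: order.trans\<close>)
      ultimately show "r \<tturnstile> (Sub b A \<and>\<^sub>i Balanced f g b)" by simp
    qed
    have cover: "s \<tturnstile> (\<exists>\<^sub>i b. b \<epsilon> G \<and>\<^sub>i x \<epsilon> b \<and>\<^sub>i Sub b a)"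
      if s: "u \<le> s" and a: "s \<tturnstile> Sub a A" "s \<tturnstile> Balanced f g a" and x: "s \<tturnstile> x \<epsilon> a" for s a x
    proof (rule exE_i[OF ex_Upair[of s a a]])
      fix r c assume r: "s \<le> r" and c: "r \<tturnstile> Upair c a a"
      have "restricted (Mem 0 1)" by (intro restrictedI)
      from relation_comprehension[OF this, of r c A id]
      show "r \<tturnstile> (\<exists>\<^sub>i b. b \<epsilon> G \<and>\<^sub>i x \<epsilon> b \<and>\<^sub>i Sub b a)"
      proof (rule bexE_i)
        fix q h
        assume q: "r \<le> q" and h: "q \<tturnstile> Hom h c A" and "q \<tturnstile> (\<forall>\<^sub>i d y. Related h d y \<leftrightarrow>\<^sub>i
          (d \<epsilon> c \<and>\<^sub>i y \<epsilon> A \<and>\<^sub>i ev (y ## d ## id) (Mem 0 1)))"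
        then have rel: "\<And>p d y. q \<le> p \<Longrightarrow>
            p \<tturnstile> Related h d y \<longleftrightarrow> p \<tturnstile> (d \<epsilon> c \<and>\<^sub>i y \<epsilon> A \<and>\<^sub>i y \<epsilon> d)"
          by (simp add: forces_iff)
        have rel_a: "p \<tturnstile> Related h a y \<longleftrightarrow> p \<tturnstile> y \<epsilon> a" if p: "q \<le> p" for p y
        proof -
          note rp = order.trans[OF q p]
          have "p \<tturnstile> a \<epsilon> c" using forces_mono[OF c rp] by (simp add: Upair_def)
          then show ?thesis
            using rel[OF p] SubD[OF a(1) order.trans[OF r rp]] by auto
        qed
        have vq: "v \<le> q" by (rule order.trans[OF order.trans[OF u s] order.trans[OF r q]])
        have "q \<tturnstile> Equalises f g h"
        proof (rule EqualisesI[OF hom[THEN forces_mono, OF vq] rel])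
          fix p d assume p: "q \<le> p" and d: "p \<tturnstile> d \<epsilon> c"
          note rp = order.trans[OF q p]
          \<comment> \<open>the domain of \<open>h\<close> is the singleton of \<open>a\<close>\<close>
          have da: "p \<tturnstile> d \<approx> a" by (rule orE_i[OF Upair_mem[OF forces_mono[OF c rp] d]])
          have "o' \<tturnstile> y \<epsilon> d \<longleftrightarrow> o' \<tturnstile> y \<epsilon> a" if "p \<le> o'" for o' y
            using forces_mono[OF da that] by (blast intro: mem_cong_right approx_sym)
          then have "o' \<tturnstile> (\<exists>\<^sub>i x. x \<epsilon> d \<and>\<^sub>i Related k x y) \<longleftrightarrow> o' \<tturnstile> (\<exists>\<^sub>i x. x \<epsilon> a \<and>\<^sub>i Related k x y)"
            if "p \<le> o'" for o' y k
            by - (rule ex_cong_i, use that order.trans in auto)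
          then show "p \<tturnstile> Balanced f g d"
            using forces_mono[OF a(2) order.trans[OF r rp]] by (simp add: Balanced_def forces_iff)
        qed
        from univ[OF vq h this] show "q \<tturnstile> (\<exists>\<^sub>i b. b \<epsilon> G \<and>\<^sub>i x \<epsilon> b \<and>\<^sub>i Sub b a)"
        proof (rule bexE_i)
          fix p h' assume p: "q \<le> p" and h': "p \<tturnstile> Hom h' c E" and comp: "p \<tturnstile> Comp h e h'"
          have "p \<tturnstile> Related h a x"
            using rel_a[OF p] forces_mono[OF x order.trans[OF r order.trans[OF q p]]] by simp
          then have "p \<tturnstile> (\<exists>\<^sub>i t. Related h' a t \<and>\<^sub>i Related e t x)"
            using Comp_Related[OF comp] by simp
          then show "p \<tturnstile> (\<exists>\<^sub>i b. b \<epsilon> G \<and>\<^sub>i x \<epsilon> b \<and>\<^sub>i Sub b a)"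
          proof (rule bexE_i)
            fix n t assume n: "p \<le> n" and t: "n \<tturnstile> Related h' a t" "n \<tturnstile> Related e t x"
            note vn = order.trans[OF vq order.trans[OF p n]]
            have tE: "n \<tturnstile> t \<epsilon> E" by (rule Hom_Related(2)[OF forces_mono[OF h' n] t(1)])
            show "n \<tturnstile> (\<exists>\<^sub>i b. b \<epsilon> G \<and>\<^sub>i x \<epsilon> b \<and>\<^sub>i Sub b a)"
            proof (rule ex_mono_i[OF ex_Image[OF forces_mono[OF e vn], of t]])
              fix m b assume m: "n \<le> m" and b: "m \<tturnstile> Image e t b"
              have "u \<le> m"
                by (rule order.trans[OF order.trans[OF order.trans[OF s r] q] order.trans[OF p order.trans[OF n m]]])
              moreover have "m \<tturnstile> (\<exists>\<^sub>i t. t \<epsilon> E \<and>\<^sub>i Image e t b)"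
                by (rule exI_i[of _ _ t]) (use b forces_mono[OF tE m] in simp)
              ultimately have "m \<tturnstile> b \<epsilon> G" using G by blast
              moreover have "m \<tturnstile> x \<epsilon> b"
                using ImageD[OF b order.refl] forces_mono[OF t(2) m] by simp
              moreover have "m \<tturnstile> Sub b a"
              proof (rule SubI)
                fix l y assume l: "m \<le> l" and y: "l \<tturnstile> y \<epsilon> b"
                note nl = order.trans[OF m l]
                have "l \<tturnstile> (\<exists>\<^sub>i t. Related h' a t \<and>\<^sub>i Related e t y)"
                  by (rule exI_i[of _ _ t])
                    (use forces_mono[OF t(1) nl] ImageD[OF b l] y in simp)
                then have "l \<tturnstile> Related h a y"
                  using Comp_Related[OF forces_mono[OF comp order.trans[OF n nl]]] by simp
                then show "l \<tturnstile> y \<epsilon> a" using rel_a[OF order.trans[OF p order.trans[OF n nl]]] by simp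
              qed
              ultimately show "m \<tturnstile> (b \<epsilon> G \<and>\<^sub>i x \<epsilon> b \<and>\<^sub>i Sub b a)" by simp
            qed
          qed
        qed
      qed
    qed
    have cover': "r \<tturnstile> (\<exists>\<^sub>i b. b \<epsilon> G \<and>\<^sub>i x \<epsilon> b \<and>\<^sub>i Sub b a)"
      if "u \<le> s" "s \<tturnstile> Sub a A" "s \<tturnstile> Balanced f g a" "s \<le> r" "r \<tturnstile> x \<epsilon> a" for s r a x
      using cover[OF order.trans[OF that(1,4)] that(2,3)[THEN forces_mono, OF that(4)] that(5)] .
    show "u \<tturnstile> ((\<forall>\<^sub>i b. b \<epsilon> G \<rightarrow>\<^sub>i Sub b A \<and>\<^sub>i Balanced f g b) \<and>\<^sub>i
      (\<forall>\<^sub>i a. Sub a A \<and>\<^sub>i Balanced f g a \<rightarrow>\<^sub>i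
        (\<forall>\<^sub>i x. x \<epsilon> a \<rightarrow>\<^sub>i (\<exists>\<^sub>i b. b \<epsilon> G \<and>\<^sub>i x \<epsilon> b \<and>\<^sub>i Sub b a))))"
      using sub cover' by (simp add: forces_imp)
  qed
qed

section \<open>Rules and pairs of relations\<close>

definition Overlaps :: "nat \<Rightarrow> nat \<Rightarrow> tv" where
  "Overlaps b a = (\<exists>\<^sub>i x. x \<epsilon> b \<and>\<^sub>i x \<epsilon> a)"

definition Rules_on :: "nat \<Rightarrow> nat \<Rightarrow> tv" where
  "Rules_on S R = (\<forall>\<^sub>i r. r \<epsilon> R \<rightarrow>\<^sub>i (\<exists>\<^sub>i a b. Opair r a b \<and>\<^sub>i Sub a S \<and>\<^sub>i Sub b S))"

definition Biclosed :: "nat \<Rightarrow> nat \<Rightarrow> tv" where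
  "Biclosed R \<alpha> =
    (\<forall>\<^sub>i r. r \<epsilon> R \<rightarrow>\<^sub>i (\<forall>\<^sub>i a b. Opair r a b \<rightarrow>\<^sub>i (Overlaps a \<alpha> \<leftrightarrow>\<^sub>i Overlaps b \<alpha>)))"

definition Rule_at :: "nat \<Rightarrow> nat \<Rightarrow> nat \<Rightarrow> nat \<Rightarrow> tv" where
  "Rule_at f g y r = (\<exists>\<^sub>i a b. Opair r a b \<and>\<^sub>i Fibre f y a \<and>\<^sub>i Fibre g y b)"

text \<open>The relations \<open>f, g\<close> present \<open>R\<close> if its rules are exactly the pairs of fibres of \<open>f\<close> and \<open>g\<close> over the points
of \<open>B\<close>.\<close>

definition Presents :: "nat \<Rightarrow> nat \<Rightarrow> nat \<Rightarrow> nat \<Rightarrow> tv" where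
  "Presents f g B R =
    ((\<forall>\<^sub>i y. y \<epsilon> B \<rightarrow>\<^sub>i (\<exists>\<^sub>i r. r \<epsilon> R \<and>\<^sub>i Rule_at f g y r)) \<and>\<^sub>i
     (\<forall>\<^sub>i r. r \<epsilon> R \<rightarrow>\<^sub>i (\<exists>\<^sub>i y. y \<epsilon> B \<and>\<^sub>i Rule_at f g y r)))"

lemma Fibre_cong:
  assumes "w \<tturnstile> a \<approx> b" "w \<tturnstile> Fibre f y a" shows "w \<tturnstile> Fibre f y b"
proof -
  have "v \<tturnstile> x \<epsilon> b \<longleftrightarrow> v \<tturnstile> x \<epsilon> a" if "w \<le> v" for v x
    using forces_mono[OF assms(1) that] by (blast intro: mem_cong_right approx_sym)
  then show ?thesis using assms(2) by (simp add: Fibre_def forces_iff)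
qed

lemma Fibre_unique: "w \<tturnstile> Fibre f y a \<Longrightarrow> w \<tturnstile> Fibre f y b \<Longrightarrow> w \<tturnstile> a \<approx> b"
  by (rule ext_of_iff) (simp add: FibreD)

lemma Rule_at_pair:
  assumes "w \<tturnstile> Rule_at f g y r" "w \<tturnstile> Opair r a b"
  shows "w \<tturnstile> Fibre f y a" "w \<tturnstile> Fibre g y b"
proof -
  have "w \<tturnstile> (Fibre f y a \<and>\<^sub>i Fibre g y b)"
  proof (rule exE2_i[OF assms(1)[unfolded Rule_at_def]])
    fix v a' b'
    assume v: "w \<le> v" and r: "v \<tturnstile> (Opair r a' b' \<and>\<^sub>i Fibre f y a' \<and>\<^sub>i Fibre g y b')"
    have "v \<tturnstile> (a' \<approx> a \<and>\<^sub>i b' \<approx> b)"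
      by (rule Opair_inj[OF _ forces_mono[OF assms(2) v]]) (use r in simp)
    then show "v \<tturnstile> (Fibre f y a \<and>\<^sub>i Fibre g y b)" using r by (auto intro: Fibre_cong)
  qed
  then show "w \<tturnstile> Fibre f y a" "w \<tturnstile> Fibre g y b" by simp_all
qed

lemma Overlaps_Fibre:
  assumes "w \<tturnstile> Fibre f y b"
  shows "w \<tturnstile> Overlaps b \<alpha> \<longleftrightarrow> w \<tturnstile> (\<exists>\<^sub>i x. x \<epsilon> \<alpha> \<and>\<^sub>i Related f x y)"
  unfolding Overlaps_def by (rule ex_cong_i) (use FibreD[OF assms] in auto)

lemma Rule_at_biclosed_iff:
  assumes "w \<tturnstile> Rule_at f g y r" "w \<tturnstile> Opair r a b"
  shows "w \<tturnstile> (Overlaps a \<alpha> \<leftrightarrow>\<^sub>i Overlaps b \<alpha>) \<longleftrightarrow>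
    w \<tturnstile> ((\<exists>\<^sub>i x. x \<epsilon> \<alpha> \<and>\<^sub>i Related f x y) \<leftrightarrow>\<^sub>i (\<exists>\<^sub>i x. x \<epsilon> \<alpha> \<and>\<^sub>i Related g x y))"
  using Overlaps_Fibre[OF forces_mono[OF Rule_at_pair(1)[OF assms]]]
    Overlaps_Fibre[OF forces_mono[OF Rule_at_pair(2)[OF assms]]]
  by (simp add: forces_iff)

lemma BiclosedD:
  assumes "w \<tturnstile> Biclosed R \<alpha>" "w \<tturnstile> r \<epsilon> R" "w \<tturnstile> Opair r a b"
  shows "w \<tturnstile> (Overlaps a \<alpha> \<leftrightarrow>\<^sub>i Overlaps b \<alpha>)"
proof -
  have "w \<tturnstile> (r \<epsilon> R \<rightarrow>\<^sub>i (\<forall>\<^sub>i a b. Opair r a b \<rightarrow>\<^sub>i (Overlaps a \<alpha> \<leftrightarrow>\<^sub>i Overlaps b \<alpha>)))"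
    using assms(1) by (simp add: Biclosed_def)
  from impE_i[OF this assms(2)]
  have "w \<tturnstile> (Opair r a b \<rightarrow>\<^sub>i (Overlaps a \<alpha> \<leftrightarrow>\<^sub>i Overlaps b \<alpha>))" by simp
  then show ?thesis using assms(3) by (rule impE_i)
qed

text \<open>The fibre of \<open>f\<close> over \<open>y\<close> meets \<open>\<alpha>\<close> exactly if \<open>f\<close> relates a member of \<open>\<alpha>\<close> to \<open>y\<close>, so the two conditions
agree rule by rule. Balancedness also concerns \<open>y\<close> outside \<open>B\<close>, but the existence of a related
element on either side forces \<open>y \<in> B\<close>.\<close>

lemma Biclosed_iff_Balanced:
  assumes hom: "w \<tturnstile> Hom f A B" "w \<tturnstile> Hom g A B" and pres: "w \<tturnstile> Presents f g B R"
  shows "w \<tturnstile> Biclosed R \<alpha> \<longleftrightarrow> w \<tturnstile> Balanced f g \<alpha>"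
proof
  assume bi: "w \<tturnstile> Biclosed R \<alpha>"
  have iff: "v \<tturnstile> ((\<exists>\<^sub>i x. x \<epsilon> \<alpha> \<and>\<^sub>i Related f x y) \<leftrightarrow>\<^sub>i (\<exists>\<^sub>i x. x \<epsilon> \<alpha> \<and>\<^sub>i Related g x y))"
    if v: "w \<le> v" and y: "v \<tturnstile> y \<epsilon> B" for v y
  proof -
    have "v \<tturnstile> (\<exists>\<^sub>i r. r \<epsilon> R \<and>\<^sub>i Rule_at f g y r)"
      using pres v y by (simp add: Presents_def forces_imp)
    then show ?thesis
    proof (rule bexE_i)
      fix u r assume u: "v \<le> u" "u \<tturnstile> r \<epsilon> R" "u \<tturnstile> Rule_at f g y r"
      show "u \<tturnstile> ((\<exists>\<^sub>i x. x \<epsilon> \<alpha> \<and>\<^sub>i Related f x y) \<leftrightarrow>\<^sub>i (\<exists>\<^sub>i x. x \<epsilon> \<alpha> \<and>\<^sub>i Related g x y))"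
      proof (rule exE2_i[OF u(3)[unfolded Rule_at_def]])
        fix t a b assume t: "u \<le> t" and ab: "t \<tturnstile> (Opair r a b \<and>\<^sub>i Fibre f y a \<and>\<^sub>i Fibre g y b)"
        have "t \<tturnstile> (Overlaps a \<alpha> \<leftrightarrow>\<^sub>i Overlaps b \<alpha>)"
          by (rule BiclosedD[OF forces_mono[OF bi order.trans[OF v order.trans[OF u(1) t]]]
                forces_mono[OF u(2) t]]) (use ab in simp)
        then show "t \<tturnstile> ((\<exists>\<^sub>i x. x \<epsilon> \<alpha> \<and>\<^sub>i Related f x y) \<leftrightarrow>\<^sub>i (\<exists>\<^sub>i x. x \<epsilon> \<alpha> \<and>\<^sub>i Related g x y))"
          using Rule_at_biclosed_iff[OF forces_mono[OF u(3) t], of a b] ab by simp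
      qed
    qed
  qed
  have in_B: "v \<tturnstile> y \<epsilon> B"
    if "w \<le> v" "v \<tturnstile> (\<exists>\<^sub>i x. x \<epsilon> \<alpha> \<and>\<^sub>i Related h x y)" "w \<tturnstile> Hom h A B" for v y h
  proof (rule bexE_i[OF that(2)])
    fix u x assume "v \<le> u" "u \<tturnstile> Related h x y"
    then show "u \<tturnstile> y \<epsilon> B"
      using Hom_Related(2)[OF forces_mono[OF that(3) order.trans[OF that(1)]]] by blast
  qed
  show "w \<tturnstile> Balanced f g \<alpha>"
    unfolding Balanced_def forces_all
  proof (intro allI iffI_i)
    fix v y assume v: "w \<le> v"
    show "v \<tturnstile> (\<exists>\<^sub>i x. x \<epsilon> \<alpha> \<and>\<^sub>i Related g x y)" if "v \<tturnstile> (\<exists>\<^sub>i x. x \<epsilon> \<alpha> \<and>\<^sub>i Related f x y)"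
      using iff[OF v in_B[OF v that hom(1)]] that by (simp add: iffD_i)
    show "v \<tturnstile> (\<exists>\<^sub>i x. x \<epsilon> \<alpha> \<and>\<^sub>i Related f x y)" if "v \<tturnstile> (\<exists>\<^sub>i x. x \<epsilon> \<alpha> \<and>\<^sub>i Related g x y)"
      using iff[OF v in_B[OF v that hom(2)]] that by (simp add: iffD_i)
  qed
next
  assume bal: "w \<tturnstile> Balanced f g \<alpha>"
  have "v \<tturnstile> (Overlaps a \<alpha> \<leftrightarrow>\<^sub>i Overlaps b \<alpha>)"
    if v: "w \<le> v" and r: "v \<tturnstile> r \<epsilon> R" and ab: "v \<tturnstile> Opair r a b" for v r a b
  proof -
    have "v \<tturnstile> (\<exists>\<^sub>i y. y \<epsilon> B \<and>\<^sub>i Rule_at f g y r)"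
      using pres v r by (simp add: Presents_def forces_imp)
    then show ?thesis
    proof (rule bexE_i)
      fix u y assume u: "v \<le> u" "u \<tturnstile> Rule_at f g y r"
      show "u \<tturnstile> (Overlaps a \<alpha> \<leftrightarrow>\<^sub>i Overlaps b \<alpha>)"
        using Rule_at_biclosed_iff[OF u(2) forces_mono[OF ab u(1)]]
          forces_mono[OF bal order.trans[OF v u(1)]] by (simp add: Balanced_def)
    qed
  qed
  then have "v \<tturnstile> (Overlaps a \<alpha> \<leftrightarrow>\<^sub>i Overlaps b \<alpha>)"
    if "w \<le> u" "u \<tturnstile> r \<epsilon> R" "u \<le> v" "v \<tturnstile> Opair r a b" for u v r a b
    using that by (meson forces_mono order.trans)
  then show "w \<tturnstile> Biclosed R \<alpha>" by (simp add: Biclosed_def forces_imp)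
qed

lemma ex_Rule_at:
  assumes hom: "w \<tturnstile> Hom f A B" "w \<tturnstile> Hom g A B"
  shows "w \<tturnstile> (\<exists>\<^sub>i r. Rule_at f g y r)"
proof (rule exE_i[OF ex_Fibre[OF hom(1), of y]])
  fix v a assume v: "w \<le> v" "v \<tturnstile> Fibre f y a"
  show "v \<tturnstile> (\<exists>\<^sub>i r. Rule_at f g y r)"
  proof (rule exE_i[OF ex_Fibre[OF forces_mono[OF hom(2) v(1)], of y]])
    fix u b assume u: "v \<le> u" "u \<tturnstile> Fibre g y b"
    show "u \<tturnstile> (\<exists>\<^sub>i r. Rule_at f g y r)"
    proof (rule ex_mono_i[OF ex_Opair[of u a b]])
      fix t r assume t: "u \<le> t" "t \<tturnstile> Opair r a b"
      show "t \<tturnstile> Rule_at f g y r"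
        unfolding Rule_at_def
        by (rule exI2_i[of _ _ a b])
          (use t forces_mono[OF v(2) order.trans[OF u(1) t(1)]] forces_mono[OF u(2) t(1)] in simp)
    qed
  qed
qed

lemma Rule_at_unique:
  assumes "w \<tturnstile> Rule_at f g y r" "w \<tturnstile> Rule_at f g y r'" shows "w \<tturnstile> r \<approx> r'"
proof (rule exE2_i[OF assms(1)[unfolded Rule_at_def]])
  fix v a b assume v: "w \<le> v" and ab: "v \<tturnstile> (Opair r a b \<and>\<^sub>i Fibre f y a \<and>\<^sub>i Fibre g y b)"
  show "v \<tturnstile> r \<approx> r'"
  proof (rule exE2_i[OF forces_mono[OF assms(2) v, unfolded Rule_at_def]])
    fix u a' b'
    assume u: "v \<le> u" and ab': "u \<tturnstile> (Opair r' a' b' \<and>\<^sub>i Fibre f y a' \<and>\<^sub>i Fibre g y b')"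
    have ab: "u \<tturnstile> Opair r a b" "u \<tturnstile> Fibre f y a" "u \<tturnstile> Fibre g y b"
      using forces_mono[OF ab u] by simp_all
    have "u \<tturnstile> a' \<approx> a" "u \<tturnstile> b' \<approx> b"
      using ab ab' by (auto intro: Fibre_unique)
    then have "u \<tturnstile> Opair r' a b" using ab' by (auto intro: Opair_cong)
    with ab(1) show "u \<tturnstile> r \<approx> r'" by (rule Opair_unique)
  qed
qed

text \<open>Replacement along \<open>B\<close>; the pair of fibres over \<open>y\<close> exists by separation and is unique by
extensionality.\<close>

lemma ex_presented_rules:
  assumes hom: "w \<tturnstile> Hom f A B" "w \<tturnstile> Hom g A B"
  shows "w \<tturnstile> (\<exists>\<^sub>i R. Rules_on A R \<and>\<^sub>i Presents f g B R)"
proof -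
  \<comment> \<open>\<open>?F\<close> describes the fibre over \<open>y\<close> of the relation at level \<open>h\<close>, in the environment \<open>x, b, a, y, r, B, f, g\<close>\<close>
  let ?F = "\<lambda>h i. Forall (And (Imp (Mem 0 i) (related h 7 4 8)) (Imp (related h 7 4 8) (Mem 0 i)))"
  let ?\<psi> = "Exists (Exists (And (is_pair 3 5 6 7) (And (?F 1 2) (?F 0 1))))"
  have \<psi>: "ev (y ## r ## B ## f ## g ## id) ?\<psi> = Rule_at f g y r" for y r
    by (simp add: Rule_at_def Fibre_def tv_iff_def ev_related ev_pair eval_nat_numeral)
  have "v \<tturnstile> (\<exists>\<^sub>i r. Rule_at f g y r \<and>\<^sub>i (\<forall>\<^sub>i r'. Rule_at f g y r' \<rightarrow>\<^sub>i r' \<approx> r))"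
    if v: "w \<le> v" for v y
    by (rule ex_mono_i[OF ex_Rule_at[OF hom[THEN forces_mono, OF v], of y]])
      (simp add: forces_imp Rule_at_unique forces_mono)
  then have "w \<tturnstile> (\<exists>\<^sub>i R. \<forall>\<^sub>i r. r \<epsilon> R \<leftrightarrow>\<^sub>i (\<exists>\<^sub>i y. y \<epsilon> B \<and>\<^sub>i Rule_at f g y r))"
    using replacement[of w B "f ## g ## id" ?\<psi>] unfolding \<psi> by blast
  then show ?thesis
  proof (rule ex_mono_i)
    fix v R assume v: "w \<le> v" and "v \<tturnstile> (\<forall>\<^sub>i r. r \<epsilon> R \<leftrightarrow>\<^sub>i (\<exists>\<^sub>i y. y \<epsilon> B \<and>\<^sub>i Rule_at f g y r))"
    then have R: "\<And>u r. v \<le> u \<Longrightarrow> u \<tturnstile> r \<epsilon> R \<longleftrightarrow> u \<tturnstile> (\<exists>\<^sub>i y. y \<epsilon> B \<and>\<^sub>i Rule_at f g y r)"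
      by (simp add: forces_iff)
    have "u \<tturnstile> (\<exists>\<^sub>i r. r \<epsilon> R \<and>\<^sub>i Rule_at f g y r)" if u: "v \<le> u" and y: "u \<tturnstile> y \<epsilon> B" for u y
    proof (rule ex_mono_i[OF ex_Rule_at[OF hom[THEN forces_mono, OF order.trans[OF v u]]]])
      fix t r assume t: "u \<le> t" "t \<tturnstile> Rule_at f g y r"
      have "t \<tturnstile> (\<exists>\<^sub>i y. y \<epsilon> B \<and>\<^sub>i Rule_at f g y r)"
        by (rule exI_i[of _ _ y]) (use t forces_mono[OF y t(1)] in simp)
      then show "t \<tturnstile> (r \<epsilon> R \<and>\<^sub>i Rule_at f g y r)" using R[OF order.trans[OF u t(1)]] t(2) by simp
    qed
    then have "v \<tturnstile> Presents f g B R" using R by (simp add: Presents_def forces_imp)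
    moreover have "u \<tturnstile> (\<exists>\<^sub>i a b. Opair r a b \<and>\<^sub>i Sub a A \<and>\<^sub>i Sub b A)"
      if u: "v \<le> u" and r: "u \<tturnstile> r \<epsilon> R" for u r
    proof (rule bexE_i[OF iffD1[OF R[OF u] r]])
      fix t y assume t: "u \<le> t" "t \<tturnstile> Rule_at f g y r"
      show "t \<tturnstile> (\<exists>\<^sub>i a b. Opair r a b \<and>\<^sub>i Sub a A \<and>\<^sub>i Sub b A)"
      proof (rule exE2_i[OF t(2)[unfolded Rule_at_def]])
        fix s a b assume s: "t \<le> s" and ab: "s \<tturnstile> (Opair r a b \<and>\<^sub>i Fibre f y a \<and>\<^sub>i Fibre g y b)"
        note ws = order.trans[OF order.trans[OF v u] order.trans[OF t(1) s]]
        have sub: "s \<tturnstile> Sub c A" if "s \<tturnstile> Fibre h y c" "w \<tturnstile> Hom h A B" for h c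
          by (rule SubI) (use FibreD[OF that(1)]
            Hom_Related(1)[OF forces_mono[OF forces_mono[OF that(2) ws]]] in blast)
        show "s \<tturnstile> (\<exists>\<^sub>i a b. Opair r a b \<and>\<^sub>i Sub a A \<and>\<^sub>i Sub b A)"
          by (rule exI2_i[of _ _ a b]) (use ab sub hom in auto)
      qed
    qed
    then have "v \<tturnstile> Rules_on A R" by (simp add: Rules_on_def forces_imp)
    ultimately show "v \<tturnstile> (Rules_on A R \<and>\<^sub>i Presents f g B R)" by simp
  qed
qed

text \<open>A statement about the components of a pair \<open>r\<close> becomes restricted by bounding them: they are elements of
elements of \<open>r\<close>.\<close>

lemma Opair_components:
  assumes pair: "w \<tturnstile> Opair r a b"
    and cong: "\<And>v a' b'. w \<le> v \<Longrightarrow> v \<tturnstile> a' \<approx> a \<Longrightarrow> v \<tturnstile> b' \<approx> b \<Longrightarrow> v \<tturnstile> P a' b' \<Longrightarrow> v \<tturnstile> P a b"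
  shows "w \<tturnstile> (\<exists>\<^sub>i u. u \<epsilon> r \<and>\<^sub>i (\<exists>\<^sub>i a'. a' \<epsilon> u \<and>\<^sub>i (\<exists>\<^sub>i v. v \<epsilon> r \<and>\<^sub>i (\<exists>\<^sub>i b'. b' \<epsilon> v \<and>\<^sub>i
      Opair r a' b' \<and>\<^sub>i P a' b')))) \<longleftrightarrow> w \<tturnstile> P a b"
    (is "w \<tturnstile> ?L \<longleftrightarrow> _")
proof
  assume "w \<tturnstile> P a b"
  show "w \<tturnstile> ?L"
  proof (rule OpairE[OF pair])
    fix v s t assume v: "w \<le> v" "v \<tturnstile> Upair s a a" "v \<tturnstile> Upair t a b" "v \<tturnstile> Upair r s t"
    show "v \<tturnstile> ?L"
      apply (rule exI_i[of _ _ s], unfold forces_and, rule conjI)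
      subgoal using v by (simp add: Upair_def)
      apply (rule exI_i[of _ _ a], unfold forces_and, rule conjI)
      subgoal using v by (simp add: Upair_def)
      apply (rule exI_i[of _ _ t], unfold forces_and, rule conjI)
      subgoal using v by (simp add: Upair_def)
      apply (rule exI_i[of _ _ b])
      using v \<open>w \<tturnstile> P a b\<close> pair by (auto simp: Upair_def intro: forces_mono)
  qed
next
  assume "w \<tturnstile> ?L"
  then show "w \<tturnstile> P a b"
  proof (rule bexE_i, elim bexE_i, unfold forces_and, elim conjE)
    fix v1 v2 v3 v a' b'
    assume "w \<le> v1" "v1 \<le> v2" "v2 \<le> v3" "v3 \<le> v" and p: "v \<tturnstile> Opair r a' b'" "v \<tturnstile> P a' b'"
    then have v: "w \<le> v" by (blast intro: order.trans)
    have "v \<tturnstile> (a' \<approx> a \<and>\<^sub>i b' \<approx> b)" by (rule Opair_inj[OF p(1) forces_mono[OF pair v]])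
    then show "v \<tturnstile> P a b" using cong[OF v _ _ p(2)] by simp
  qed
qed

text \<open>The relation that holds between \<open>x\<close> and the rule \<open>r\<close> if \<open>x\<close> belongs to the first (if \<open>left\<close>) or to the second
component of \<open>r\<close>. Its fibre over \<open>r\<close> is the whole component because the components of rules on \<open>S\<close> are
subsets of \<open>S\<close>.\<close>

lemma ex_relation_of_component:
  fixes left :: bool
  assumes rules: "w \<tturnstile> Rules_on S R"
  shows "w \<tturnstile> (\<exists>\<^sub>i f. Hom f S R \<and>\<^sub>i
    (\<forall>\<^sub>i r a b. r \<epsilon> R \<and>\<^sub>i Opair r a b \<rightarrow>\<^sub>i Fibre f r (if left then a else b)))"
proof -
  \<comment> \<open>\<open>\<exists>u\<in>r. \<exists>a\<in>u. \<exists>v\<in>r. \<exists>b\<in>v. r = (a, b) \<and> x \<in> a\<close> (or \<open>x \<in> b\<close>) in the environment \<open>r, x\<close>\<close>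
  let ?\<phi> = "Exists (And (Mem 0 1) (Exists (And (Mem 0 1) (Exists (And (Mem 0 3) (Exists
    (And (Mem 0 1) (And (is_pair 1 3 5 6) (Mem 5 (if left then 2 else 0))))))))))"
  let ?c = "\<lambda>a b. if left then a else b"
  have "restricted ?\<phi>" by (intro restrictedI restricted_pair) simp_all
  from relation_comprehension[OF this, of w S R id] show ?thesis
  proof (rule ex_mono_i, unfold forces_and, elim conjE, intro conjI)
    fix v f
    assume v: "w \<le> v" and hom: "v \<tturnstile> Hom f S R" and "v \<tturnstile> (\<forall>\<^sub>i x r. Related f x r \<leftrightarrow>\<^sub>i
      (x \<epsilon> S \<and>\<^sub>i r \<epsilon> R \<and>\<^sub>i ev (r ## x ## id) ?\<phi>))"
    then have rel: "u \<tturnstile> Related f x r \<longleftrightarrow> u \<tturnstile> x \<epsilon> S \<and> u \<tturnstile> r \<epsilon> R \<and>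
        u \<tturnstile> (\<exists>\<^sub>i u. u \<epsilon> r \<and>\<^sub>i (\<exists>\<^sub>i a'. a' \<epsilon> u \<and>\<^sub>i (\<exists>\<^sub>i v. v \<epsilon> r \<and>\<^sub>i (\<exists>\<^sub>i b'. b' \<epsilon> v \<and>\<^sub>i
          Opair r a' b' \<and>\<^sub>i x \<epsilon> ?c a' b'))))" if "v \<le> u" for u x r
      using that by (cases left) (simp_all add: forces_iff ev_pair eval_nat_numeral)
    have "u \<tturnstile> Fibre f r (?c a b)"
      if u: "v \<le> u" and r: "u \<tturnstile> r \<epsilon> R" and ab: "u \<tturnstile> Opair r a b" for u r a b
    proof -
      have sub: "u \<tturnstile> (Sub a S \<and>\<^sub>i Sub b S)"
      proof -
        have "u \<tturnstile> (\<exists>\<^sub>i a b. Opair r a b \<and>\<^sub>i Sub a S \<and>\<^sub>i Sub b S)"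
          using rules order.trans[OF v u] r by (simp add: Rules_on_def forces_imp)
        then show ?thesis
        proof (rule exE2_i)
          fix t a' b' assume t: "u \<le> t" and p: "t \<tturnstile> (Opair r a' b' \<and>\<^sub>i Sub a' S \<and>\<^sub>i Sub b' S)"
          have eq: "t \<tturnstile> (a \<approx> a' \<and>\<^sub>i b \<approx> b')"
            by (rule Opair_inj[OF forces_mono[OF ab t]]) (use p in simp)
          have "t \<tturnstile> Sub d S" if "t \<tturnstile> d \<approx> d'" "t \<tturnstile> Sub d' S" for d d'
            by (rule SubI) (use that in \<open>blast intro: SubD mem_cong_right forces_mono\<close>)
          then show "t \<tturnstile> (Sub a S \<and>\<^sub>i Sub b S)" using eq p by auto
        qed
      qed
      have "t \<tturnstile> x \<epsilon> ?c a b \<longleftrightarrow> t \<tturnstile> Related f x r" if t: "u \<le> t" for t x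
      proof -
        have "t \<tturnstile> x \<epsilon> ?c a b \<Longrightarrow> t \<tturnstile> x \<epsilon> S"
          using sub SubD[OF _ t] by (auto split: if_splits)
        moreover have "t \<tturnstile> (\<exists>\<^sub>i u. u \<epsilon> r \<and>\<^sub>i (\<exists>\<^sub>i a'. a' \<epsilon> u \<and>\<^sub>i (\<exists>\<^sub>i v. v \<epsilon> r \<and>\<^sub>i
            (\<exists>\<^sub>i b'. b' \<epsilon> v \<and>\<^sub>i Opair r a' b' \<and>\<^sub>i x \<epsilon> ?c a' b')))) \<longleftrightarrow> t \<tturnstile> x \<epsilon> ?c a b"
          by (rule Opair_components[OF forces_mono[OF ab t]])
            (auto intro: mem_cong_right split: if_splits)
        ultimately show ?thesis
          using rel[OF order.trans[OF u t]] forces_mono[OF r t] by auto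
      qed
      then show ?thesis by (simp add: Fibre_def forces_iff)
    qed
    then show "v \<tturnstile> (\<forall>\<^sub>i r a b. r \<epsilon> R \<and>\<^sub>i Opair r a b \<rightarrow>\<^sub>i Fibre f r (?c a b))"
      by (simp add: forces_imp)
  qed
qed

lemma ex_presenting_relations:
  assumes rules: "w \<tturnstile> Rules_on S R"
  shows "w \<tturnstile> (\<exists>\<^sub>i f g. Hom f S R \<and>\<^sub>i Hom g S R \<and>\<^sub>i Presents f g R R)"
proof (rule bexE_i[OF ex_relation_of_component[OF rules, where left = True]])
  fix v f
  assume v: "w \<le> v" and f: "v \<tturnstile> Hom f S R"
    "v \<tturnstile> (\<forall>\<^sub>i r a b. r \<epsilon> R \<and>\<^sub>i Opair r a b \<rightarrow>\<^sub>i Fibre f r (if True then a else b))"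
  show "v \<tturnstile> (\<exists>\<^sub>i f g. Hom f S R \<and>\<^sub>i Hom g S R \<and>\<^sub>i Presents f g R R)"
  proof (rule bexE_i[OF ex_relation_of_component[OF forces_mono[OF rules v], where left = False]])
    fix u g
    assume u: "v \<le> u" and g: "u \<tturnstile> Hom g S R"
      "u \<tturnstile> (\<forall>\<^sub>i r a b. r \<epsilon> R \<and>\<^sub>i Opair r a b \<rightarrow>\<^sub>i Fibre g r (if False then a else b))"
    have rule: "t \<tturnstile> Rule_at f g r r" if t: "u \<le> t" and r: "t \<tturnstile> r \<epsilon> R" for t r
    proof -
      have "t \<tturnstile> (\<exists>\<^sub>i a b. Opair r a b \<and>\<^sub>i Sub a S \<and>\<^sub>i Sub b S)"
        using rules order.trans[OF v order.trans[OF u t]] r by (simp add: Rules_on_def forces_imp)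
      then show ?thesis
      proof (rule exE2_i)
        fix s a b assume s: "t \<le> s" and ab: "s \<tturnstile> (Opair r a b \<and>\<^sub>i Sub a S \<and>\<^sub>i Sub b S)"
        have r: "s \<tturnstile> r \<epsilon> R" by (rule forces_mono[OF r s])
        have "s \<tturnstile> Fibre f r a"
          using f(2) r ab order.trans[OF u order.trans[OF t s]] by (auto simp: forces_imp)
        moreover have "s \<tturnstile> Fibre g r b"
          using g(2) r ab order.trans[OF t s] by (auto simp: forces_imp)
        ultimately show "s \<tturnstile> Rule_at f g r r"
          unfolding Rule_at_def by - (rule exI2_i[of _ _ a b], use ab in simp)
      qed
    qed
    have "t \<tturnstile> (\<exists>\<^sub>i q. q \<epsilon> R \<and>\<^sub>i Rule_at f g r q)" "t \<tturnstile> (\<exists>\<^sub>i q. q \<epsilon> R \<and>\<^sub>i Rule_at f g q r)"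
      if "u \<le> t" "t \<tturnstile> r \<epsilon> R" for t r
      by (rule exI_i[of _ _ r]; use rule that in simp)+
    then have "u \<tturnstile> Presents f g R R" by (simp add: Presents_def forces_imp)
    then show "u \<tturnstile> (\<exists>\<^sub>i f g. Hom f S R \<and>\<^sub>i Hom g S R \<and>\<^sub>i Presents f g R R)"
      by - (rule exI2_i[of _ _ f g], use g forces_mono[OF f(1) u] in simp)
  qed
qed

lemma Set_generated_mono:
  assumes gen: "w \<tturnstile> Set_generated C"
    and eq: "\<And>v a. w \<le> v \<Longrightarrow> v \<tturnstile> C a \<longleftrightarrow> v \<tturnstile> D a"
  shows "w \<tturnstile> Set_generated D"
  using gen unfolding Set_generated_def
proof (rule ex_mono_i)
  fix v G
  assume v: "w \<le> v" and "v \<tturnstile> ((\<forall>\<^sub>i b. b \<epsilon> G \<rightarrow>\<^sub>i C b) \<and>\<^sub>i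
    (\<forall>\<^sub>i a. C a \<rightarrow>\<^sub>i (\<forall>\<^sub>i x. x \<epsilon> a \<rightarrow>\<^sub>i (\<exists>\<^sub>i b. b \<epsilon> G \<and>\<^sub>i x \<epsilon> b \<and>\<^sub>i Sub b a))))"
  then show "v \<tturnstile> ((\<forall>\<^sub>i b. b \<epsilon> G \<rightarrow>\<^sub>i D b) \<and>\<^sub>i
    (\<forall>\<^sub>i a. D a \<rightarrow>\<^sub>i (\<forall>\<^sub>i x. x \<epsilon> a \<rightarrow>\<^sub>i (\<exists>\<^sub>i b. b \<epsilon> G \<and>\<^sub>i x \<epsilon> b \<and>\<^sub>i Sub b a))))"
    using eq[OF order.trans[OF v]] by (simp add: forces_imp)
qed

section \<open>The equivalence\<close>

lemma ev_overlaps: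
  "i < n \<Longrightarrow> j < n \<Longrightarrow> ev e (overlaps i j n) = Overlaps (e (n - Suc i)) (e (n - Suc j))"
  by (simp add: overlaps_def connectives Overlaps_def lookup)

lemma ev_rules_on:
  "i < n \<Longrightarrow> j < n \<Longrightarrow> ev e (rules_on i j n) = Rules_on (e (n - Suc i)) (e (n - Suc j))"
  by (simp add: rules_on_def connectives Rules_on_def lookup ev_pair ev_subset Suc_diff_le)

lemma ev_biclosed:
  "i < n \<Longrightarrow> j < n \<Longrightarrow> ev e (biclosed i j n) = Biclosed (e (n - Suc i)) (e (n - Suc j))"
  by (simp add: biclosed_def connectives Biclosed_def lookup ev_pair ev_overlaps Suc_diff_le)

lemma ev_rel_hom:
  "i < n \<Longrightarrow> j < n \<Longrightarrow> k < n \<Longrightarrow>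
    ev e (rel_hom i j k n) = Hom (e (n - Suc i)) (e (n - Suc j)) (e (n - Suc k))"
  by (simp add: rel_hom_def connectives Hom_def lookup ev_pair Suc_diff_le)

lemma ev_rel_comp:
  "i < n \<Longrightarrow> j < n \<Longrightarrow> k < n \<Longrightarrow>
    ev e (rel_comp i j k n) = Comp (e (n - Suc i)) (e (n - Suc j)) (e (n - Suc k))"
  by (simp add: rel_comp_def connectives Comp_def lookup ev_pair ev_related Suc_diff_le)

lemma ev_NID_bi:
  "ev e (NID_bi 0) =
    (\<forall>\<^sub>i S R. Rules_on S R \<rightarrow>\<^sub>i Set_generated (\<lambda>a. Sub a S \<and>\<^sub>i Biclosed R a))"
  by (simp add: NID_bi_def set_generated_def connectives Set_generated_def ev_rules_on ev_subset
      ev_biclosed)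

lemma ev_Rel_has_weak_equalisers:
  "ev e (Rel_has_weak_equalisers 0) =
    (\<forall>\<^sub>i A B f g. Hom f A B \<and>\<^sub>i Hom g A B \<rightarrow>\<^sub>i Weak_equaliser A f g)"
  by (simp add: Rel_has_weak_equalisers_def has_weak_equalisers_def connectives Weak_equaliser_def
      ev_rel_hom ev_rel_comp)

lemma NID_bi_imp_weak_equaliser:
  assumes nid: "w \<tturnstile> ev e (NID_bi 0)" and hom: "w \<tturnstile> Hom f A B" "w \<tturnstile> Hom g A B"
  shows "w \<tturnstile> Weak_equaliser A f g"
proof (rule bexE_i[OF ex_presented_rules[OF hom]])
  fix v R assume v: "w \<le> v" and R: "v \<tturnstile> Rules_on A R" "v \<tturnstile> Presents f g B R"
  note hom = hom[THEN forces_mono, OF v]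
  have "v \<tturnstile> Set_generated (\<lambda>a. Sub a A \<and>\<^sub>i Biclosed R a)"
    using nid v R(1) by (simp add: ev_NID_bi forces_imp)
  then have "v \<tturnstile> Set_generated (\<lambda>a. Sub a A \<and>\<^sub>i Balanced f g a)"
    by (rule Set_generated_mono)
      (use Biclosed_iff_Balanced[OF hom[THEN forces_mono] forces_mono[OF R(2)]] in simp)
  then show "v \<tturnstile> Weak_equaliser A f g" by (rule Weak_equaliser_of_Set_generated[OF hom])
qed

lemma weak_equalisers_imp_set_generated:
  assumes weq: "w \<tturnstile> ev e (Rel_has_weak_equalisers 0)" and rules: "w \<tturnstile> Rules_on S R"
  shows "w \<tturnstile> Set_generated (\<lambda>a. Sub a S \<and>\<^sub>i Biclosed R a)"
proof (rule exE2_i[OF ex_presenting_relations[OF rules]], unfold forces_and, elim conjE)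
  fix v f g
  assume v: "w \<le> v" and hom: "v \<tturnstile> Hom f S R" "v \<tturnstile> Hom g S R" and R: "v \<tturnstile> Presents f g R R"
  have "v \<tturnstile> Weak_equaliser S f g"
    using weq v hom by (simp add: ev_Rel_has_weak_equalisers forces_imp)
  with hom have "v \<tturnstile> Set_generated (\<lambda>a. Sub a S \<and>\<^sub>i Balanced f g a)"
    by (rule Set_generated_of_Weak_equaliser)
  then show "v \<tturnstile> Set_generated (\<lambda>a. Sub a S \<and>\<^sub>i Biclosed R a)"
    by (rule Set_generated_mono)
      (use Biclosed_iff_Balanced[OF hom[THEN forces_mono] forces_mono[OF R]] in simp)
qed

theorem proposition10:
  "ECST \<turnstile> (NID_bi \<^bold>\<longleftrightarrow> Rel_has_weak_equalisers) 0"
proof (rule derivesI_ev)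
  let ?N = "ev (\<lambda>i. i) (NID_bi 0)" and ?W = "ev (\<lambda>i. i) (Rel_has_weak_equalisers 0)"
  have "{||} \<tturnstile> (?N \<leftrightarrow>\<^sub>i ?W)"
  proof (rule iffI_i)
    fix v assume "v \<tturnstile> ?N"
    then show "v \<tturnstile> ?W"
      unfolding ev_Rel_has_weak_equalisers
      by (auto simp: forces_imp intro: NID_bi_imp_weak_equaliser forces_mono)
  next
    fix v assume "v \<tturnstile> ?W"
    then show "v \<tturnstile> ?N"
      unfolding ev_NID_bi
      by (auto simp: forces_imp intro: weak_equalisers_imp_set_generated forces_mono)
  qed
  then show "{||} \<tturnstile> ev (\<lambda>i. i) ((NID_bi \<^bold>\<longleftrightarrow> Rel_has_weak_equalisers) 0)"
    by (simp add: connectives)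
qed

end
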